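(* Any pseudo-Riemannian weakly symmetric manifold $(M,\langle,\rangle)$ is geodesically complete.
   Context: A pseudo-Riemannian manifold $(M,\langle,\rangle)$ is a smooth manifold $M$ with a (smoothly varying, symmetric) nondegenerate inner product $\langle,\rangle$ on the fibers of its tangent bundle. An isometry of $(M,\langle,\rangle)$ is a diffeomorphism of $M$ preserving $\langle,\rangle$. It is geodesically complete if every maximal geodesic is defined on the entire real line. $(M,\langle,\rangle)$ is a pseudo-Riemannian weakly symmetric manifold (or space) if for every $x\in M$ and every nonzero $\xi\in T_xM$ there is an isometry $\phi=\phi_{x,\xi}$ of $(M,\langle,\rangle)$ such that $\phi(x)=x$ and $d\phi(\xi)=-\xi$. *)

theory Defs
  imports "HOL-Analysis.Analysis"
begin

text \<open>
  Smooth manifolds are given by a topology and a smooth atlas.  The model space is a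
  finite-dimensional inner product space \<open>'e\<close>.  Class \<open>euclidean_space\<close> is not used for it
  because it forces the dimension to be at least one; here dimension zero is included.
\<close>

subsection \<open>Smooth functions on open sets\<close>

text \<open>
  For open \<open>S\<close> in a finite-dimensional space, this is the usual class of \<open>k\<close> times
  continuously differentiable functions, with iterated directional derivatives.
\<close>

primrec C_k_on ::
  "nat \<Rightarrow> 'a::real_normed_vector set \<Rightarrow> ('a \<Rightarrow> 'b::real_normed_vector) \<Rightarrow> bool" where
  "C_k_on 0 S f \<longleftrightarrow> continuous_on S f"
| "C_k_on (Suc k) S f \<longleftrightarrow>
     (\<forall>x\<in>S. f differentiable (at x)) \<and>
     (\<forall>v. C_k_on k S (\<lambda>x. frechet_derivative f (at x) v))"

definition smooth_on ::
  "'a::real_normed_vector set \<Rightarrow> ('a \<Rightarrow> 'b::real_normed_vector) \<Rightarrow> bool" where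
  "smooth_on S f \<longleftrightarrow> (\<forall>k. C_k_on k S f)"

subsection \<open>Smooth manifolds and smooth maps\<close>

type_synonym ('a, 'e) chart = "'a set \<times> ('a \<Rightarrow> 'e)"

abbreviation chart_dom :: "('a, 'e) chart \<Rightarrow> 'a set" where
  "chart_dom c \<equiv> fst c"

abbreviation chart_map :: "('a, 'e) chart \<Rightarrow> 'a \<Rightarrow> 'e" where
  "chart_map c \<equiv> snd c"

definition chart_inv :: "('a, 'e) chart \<Rightarrow> 'e \<Rightarrow> 'a" where
  "chart_inv c = inv_into (chart_dom c) (chart_map c)"

definition is_chart :: "'a topology \<Rightarrow> ('a, 'e::topological_space) chart \<Rightarrow> bool" where
  "is_chart X c \<longleftrightarrow>
     openin X (chart_dom c) \<and> open (chart_map c ` chart_dom c) \<and>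
     homeomorphic_map (subtopology X (chart_dom c))
       (top_of_set (chart_map c ` chart_dom c)) (chart_map c)"

definition transition :: "('a, 'e) chart \<Rightarrow> ('a, 'e) chart \<Rightarrow> 'e \<Rightarrow> 'e" where
  "transition c c' = chart_map c' \<circ> chart_inv c"

text \<open>The atlas need not be maximal: all notions below depend only on the smooth structure it
  generates.\<close>

definition smooth_manifold :: "'a topology \<Rightarrow> ('a, 'e::real_inner) chart set \<Rightarrow> bool" where
  "smooth_manifold X A \<longleftrightarrow>
     (\<exists>B::'e set. finite B \<and> span B = UNIV) \<and>
     Hausdorff_space X \<and> second_countable X \<and>
     (\<forall>c\<in>A. is_chart X c) \<and> (\<Union>c\<in>A. chart_dom c) = topspace X \<and>
     (\<forall>c\<in>A. \<forall>c'\<in>A.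
        smooth_on (chart_map c ` (chart_dom c \<inter> chart_dom c')) (transition c c'))"

definition smooth_map ::
  "'a topology \<Rightarrow> ('a, 'e::real_inner) chart set \<Rightarrow>
   'b topology \<Rightarrow> ('b, 'f::real_inner) chart set \<Rightarrow> ('a \<Rightarrow> 'b) \<Rightarrow> bool" where
  "smooth_map X A Y B \<phi> \<longleftrightarrow>
     continuous_map X Y \<phi> \<and>
     (\<forall>c\<in>A. \<forall>c'\<in>B.
        smooth_on (chart_map c ` (chart_dom c \<inter> \<phi> -` chart_dom c'))
          (chart_map c' \<circ> \<phi> \<circ> chart_inv c))"

definition diffeomorphism ::
  "'a topology \<Rightarrow> ('a, 'e::real_inner) chart set \<Rightarrow> ('a \<Rightarrow> 'a) \<Rightarrow> bool" where
  "diffeomorphism X A \<phi> \<longleftrightarrow>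
     bij_betw \<phi> (topspace X) (topspace X) \<and>
     smooth_map X A X A \<phi> \<and> smooth_map X A X A (inv_into (topspace X) \<phi>)"

subsection \<open>Tangent spaces\<close>

text \<open>
  A tangent vector at \<open>p\<close> assigns to each chart around \<open>p\<close> a coordinate vector, subject to the
  transformation law under changes of charts; its values on the other charts are irrelevant and
  fixed to be zero.  The vector space operations are pointwise.
\<close>

type_synonym ('a, 'e) tangent = "('a, 'e) chart \<Rightarrow> 'e"

definition charts_at :: "('a, 'e) chart set \<Rightarrow> 'a \<Rightarrow> ('a, 'e) chart set" where
  "charts_at A p = {c \<in> A. p \<in> chart_dom c}"

definition tangent_space ::
  "('a, 'e::real_inner) chart set \<Rightarrow> 'a \<Rightarrow> ('a, 'e) tangent set" where
  "tangent_space A p =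
     {\<xi>. (\<forall>c\<in>charts_at A p. \<forall>c'\<in>charts_at A p.
            \<xi> c' = frechet_derivative (transition c c') (at (chart_map c p)) (\<xi> c)) \<and>
         (\<forall>c. c \<notin> charts_at A p \<longrightarrow> \<xi> c = 0)}"

text \<open>The tangent vector at \<open>p\<close> with coordinate vector \<open>u\<close> in the chart \<open>c\<close>.\<close>

definition tangent_of ::
  "('a, 'e::real_inner) chart set \<Rightarrow> ('a, 'e) chart \<Rightarrow> 'a \<Rightarrow> 'e \<Rightarrow> ('a, 'e) tangent" where
  "tangent_of A c p u =
     (\<lambda>c'. if c' \<in> charts_at A p
           then frechet_derivative (transition c c') (at (chart_map c p)) u else 0)"

text \<open>The differential of \<open>\<phi>\<close> at \<open>p\<close>; by the transformation law, the choice of the chart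
  \<open>c\<close> around \<open>p\<close> does not matter.\<close>

definition differential ::
  "('a, 'e::real_inner) chart set \<Rightarrow> ('a \<Rightarrow> 'a) \<Rightarrow> 'a \<Rightarrow> ('a, 'e) tangent \<Rightarrow> ('a, 'e) tangent"
  where
  "differential A \<phi> p \<xi> =
     (let c = (SOME c. c \<in> charts_at A p) in
      (\<lambda>c'. if c' \<in> charts_at A (\<phi> p)
            then frechet_derivative (chart_map c' \<circ> \<phi> \<circ> chart_inv c)
                   (at (chart_map c p)) (\<xi> c)
            else 0))"

subsection \<open>Pseudo-Riemannian manifolds and their isometries\<close>

type_synonym ('a, 'e) metric_tensor = "'a \<Rightarrow> ('a, 'e) tangent \<Rightarrow> ('a, 'e) tangent \<Rightarrow> real"

definition metric_in_chart ::
  "('a, 'e::real_inner) chart set \<Rightarrow> ('a, 'e) metric_tensor \<Rightarrow> ('a, 'e) chart \<Rightarrow>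
   'e \<Rightarrow> 'e \<Rightarrow> 'e \<Rightarrow> real" where
  "metric_in_chart A g c x u v =
     g (chart_inv c x) (tangent_of A c (chart_inv c x) u) (tangent_of A c (chart_inv c x) v)"

definition nondegenerate_inner_product ::
  "('a, 'e::real_inner) tangent set \<Rightarrow>
   (('a, 'e) tangent \<Rightarrow> ('a, 'e) tangent \<Rightarrow> real) \<Rightarrow> bool" where
  "nondegenerate_inner_product T b \<longleftrightarrow>
     (\<forall>\<xi>\<in>T. \<forall>\<eta>\<in>T. \<forall>\<zeta>\<in>T. b (\<lambda>c. \<xi> c + \<eta> c) \<zeta> = b \<xi> \<zeta> + b \<eta> \<zeta>) \<and>
     (\<forall>r. \<forall>\<xi>\<in>T. \<forall>\<zeta>\<in>T. b (\<lambda>c. r *\<^sub>R \<xi> c) \<zeta> = r * b \<xi> \<zeta>) \<and>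
     (\<forall>\<xi>\<in>T. \<forall>\<eta>\<in>T. b \<xi> \<eta> = b \<eta> \<xi>) \<and>
     (\<forall>\<xi>\<in>T. (\<forall>\<eta>\<in>T. b \<xi> \<eta> = 0) \<longrightarrow> \<xi> = (\<lambda>c. 0))"

definition pseudo_riemannian_manifold ::
  "'a topology \<Rightarrow> ('a, 'e::real_inner) chart set \<Rightarrow> ('a, 'e) metric_tensor \<Rightarrow> bool" where
  "pseudo_riemannian_manifold X A g \<longleftrightarrow>
     smooth_manifold X A \<and>
     (\<forall>p\<in>topspace X. nondegenerate_inner_product (tangent_space A p) (g p)) \<and>
     (\<forall>c\<in>A. \<forall>u v. smooth_on (chart_map c ` chart_dom c) (\<lambda>x. metric_in_chart A g c x u v))"

definition isometry ::
  "'a topology \<Rightarrow> ('a, 'e::real_inner) chart set \<Rightarrow> ('a, 'e) metric_tensor \<Rightarrow>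
   ('a \<Rightarrow> 'a) \<Rightarrow> bool" where
  "isometry X A g \<phi> \<longleftrightarrow>
     diffeomorphism X A \<phi> \<and>
     (\<forall>p\<in>topspace X. \<forall>\<xi>\<in>tangent_space A p. \<forall>\<eta>\<in>tangent_space A p.
        g (\<phi> p) (differential A \<phi> p \<xi>) (differential A \<phi> p \<eta>) = g p \<xi> \<eta>)"

subsection \<open>Geodesics\<close>

text \<open>
  The Christoffel symbols of the Levi-Civita connection in the chart \<open>c\<close>, as the bilinear map
  \<open>(u, v) \<mapsto> \<Gamma>\<^sup>k\<^sub>i\<^sub>j u\<^sup>i v\<^sup>j\<close>: this is the Koszul formula for
  the (commuting) coordinate vector fields with constant components \<open>u\<close>, \<open>v\<close>, \<open>w\<close>.
\<close>

definition christoffel ::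
  "('a, 'e::real_inner) chart set \<Rightarrow> ('a, 'e) metric_tensor \<Rightarrow> ('a, 'e) chart \<Rightarrow>
   'e \<Rightarrow> 'e \<Rightarrow> 'e \<Rightarrow> 'e" where
  "christoffel A g c x u v =
     (THE z. \<forall>w. metric_in_chart A g c x z w =
        (frechet_derivative (\<lambda>y. metric_in_chart A g c y v w) (at x) u
         + frechet_derivative (\<lambda>y. metric_in_chart A g c y u w) (at x) v
         - frechet_derivative (\<lambda>y. metric_in_chart A g c y u v) (at x) w) / 2)"

definition smooth_curve ::
  "'a topology \<Rightarrow> ('a, 'e::real_inner) chart set \<Rightarrow> real set \<Rightarrow> (real \<Rightarrow> 'a) \<Rightarrow> bool" where
  "smooth_curve X A J \<gamma> \<longleftrightarrow>
     continuous_map (top_of_set J) X \<gamma> \<and>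
     (\<forall>c\<in>A. smooth_on (J \<inter> \<gamma> -` chart_dom c) (chart_map c \<circ> \<gamma>))"

text \<open>The vanishing of the covariant derivative of the velocity field, in every chart.\<close>

definition geodesic ::
  "'a topology \<Rightarrow> ('a, 'e::real_inner) chart set \<Rightarrow> ('a, 'e) metric_tensor \<Rightarrow>
   real set \<Rightarrow> (real \<Rightarrow> 'a) \<Rightarrow> bool" where
  "geodesic X A g J \<gamma> \<longleftrightarrow>
     open J \<and> is_interval J \<and> J \<noteq> {} \<and> smooth_curve X A J \<gamma> \<and>
     (\<forall>c\<in>A. \<forall>t\<in>J. \<gamma> t \<in> chart_dom c \<longrightarrow>
        (let y = chart_map c \<circ> \<gamma>; y' = (\<lambda>s. vector_derivative y (at s)) in
         vector_derivative y' (at t) + christoffel A g c (y t) (y' t) (y' t) = 0))"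

definition maximal_geodesic ::
  "'a topology \<Rightarrow> ('a, 'e::real_inner) chart set \<Rightarrow> ('a, 'e) metric_tensor \<Rightarrow>
   real set \<Rightarrow> (real \<Rightarrow> 'a) \<Rightarrow> bool" where
  "maximal_geodesic X A g J \<gamma> \<longleftrightarrow>
     geodesic X A g J \<gamma> \<and>
     (\<forall>J' \<gamma>'. geodesic X A g J' \<gamma>' \<and> J \<subseteq> J' \<and> (\<forall>t\<in>J. \<gamma>' t = \<gamma> t) \<longrightarrow> J' = J)"

definition geodesically_complete ::
  "'a topology \<Rightarrow> ('a, 'e::real_inner) chart set \<Rightarrow> ('a, 'e) metric_tensor \<Rightarrow> bool" where
  "geodesically_complete X A g \<longleftrightarrow>
     (\<forall>J \<gamma>. maximal_geodesic X A g J \<gamma> \<longrightarrow> J = UNIV)"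

subsection \<open>Weak symmetry\<close>

definition weakly_symmetric ::
  "'a topology \<Rightarrow> ('a, 'e::real_inner) chart set \<Rightarrow> ('a, 'e) metric_tensor \<Rightarrow> bool" where
  "weakly_symmetric X A g \<longleftrightarrow>
     (\<forall>x\<in>topspace X. \<forall>\<xi>\<in>tangent_space A x. \<xi> \<noteq> (\<lambda>c. 0) \<longrightarrow>
        (\<exists>\<phi>. isometry X A g \<phi> \<and> \<phi> x = x \<and> differential A \<phi> x \<xi> = (\<lambda>c. - \<xi> c)))"

end

theory Submission
  imports Defs
begin

text \<open>A maximal geodesic \<open>\<gamma>\<close> on an open interval \<open>J\<close> can be reflected at any of its points.  Fix \<open>t0 \<in> J\<close> and
  suppose that \<open>\<gamma>\<close> is not constant.  An isometry \<open>\<phi>\<close> that fixes \<open>\<gamma> t0\<close> and reverses the velocity there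
  carries the time-reversed curve \<open>s \<mapsto> \<gamma> (2 * t0 - s)\<close> to a geodesic with the same position and
  velocity at \<open>t0\<close> as \<open>\<gamma>\<close>.  By uniqueness the two agree on the common part of their domains, hence
  they glue to a geodesic on the union of \<open>J\<close> and its mirror image about \<open>t0\<close>.  Maximality puts the
  mirror image into \<open>J\<close> (lemma \<open>maximal_geodesic_reflect\<close>), and an open interval that is closed under
  reflection at each of its points is the whole line (lemma \<open>interval_closed_under_reflection\<close>).

  Two facts about geodesics carry this argument.

  Uniqueness for given initial data (\<open>geodesic_eq_unique\<close> in a chart, \<open>geodesic_unique\<close> on the
  manifold).  The geodesic equation is kept in its weak form
  \<open>h (y'', w) + koszul (y', y', w) = 0\<close> for all \<open>w\<close>, whose left-hand side is locally Lipschitz in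
  position, velocity and acceleration.  Nondegeneracy then bounds the difference of the accelerations
  of two geodesics by the difference of their positions and velocities, and a Gronwall estimate
  follows.  On the manifold, a connectedness argument extends local to global uniqueness.

  Invariance under isometries (\<open>geodesic_isometry\<close>).  In charts, an isometry is a smooth map \<open>F\<close> with
  \<open>k (F x) (DF u) (DF v) = h x u v\<close>.  Differentiating this identity and using the symmetry of second
  derivatives gives the transformation law \<open>\<Gamma>\<^sub>k (DF u, DF u) + D\<^sup>2F (u, u) = DF (\<Gamma>\<^sub>h (u, u))\<close> of the Christoffel
  symbols (\<open>christoffel_of_transform\<close>), and \<open>D\<^sup>2F (y', y')\<close> is also the term by which the acceleration
  of \<open>F \<circ> y\<close> differs from \<open>DF y''\<close>.\<close>

section \<open>Finite-dimensional inner product spaces\<close>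

text \<open>An orthonormal basis replaces the fixed basis of class \<open>euclidean_space\<close>, which would exclude
  model spaces of dimension zero.\<close>

locale orthonormal_basis =
  fixes B :: "'e::real_inner set"
  assumes finite_B: "finite B"
    and span_B: "span B = UNIV"
    and inner_B: "b \<in> B \<Longrightarrow> b' \<in> B \<Longrightarrow> b \<bullet> b' = (if b = b' then 1 else 0)"

lemma orthonormal_basis_exists:
  assumes "\<exists>B::'e::real_inner set. finite B \<and> span B = UNIV"
  shows "\<exists>B::'e set. orthonormal_basis B"
proof -
  obtain C :: "'e set" where C: "finite C" "span C = UNIV" "pairwise orthogonal C"
    using assms basis_orthogonal by metis
  define B where "B = (\<lambda>x. x /\<^sub>R norm x) ` (C - {0})"
  have "C \<subseteq> span B"
  proof
    fix x assume "x \<in> C"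
    show "x \<in> span B"
    proof (cases "x = 0")
      case False
      then have "x /\<^sub>R norm x \<in> span B"
        using \<open>x \<in> C\<close> by (auto simp: B_def intro: span_base)
      then have "norm x *\<^sub>R (x /\<^sub>R norm x) \<in> span B"
        by (rule span_scale)
      then show ?thesis using False by simp
    qed (simp add: span_zero)
  qed
  then have "span B = UNIV"
    using C(2) by (metis span_minimal subspace_span top.extremum_uniqueI)
  moreover have "finite B" using C(1) by (simp add: B_def)
  moreover have "b \<bullet> b' = (if b = b' then 1 else 0)" if bb: "b \<in> B" "b' \<in> B" for b b'
  proof -
    obtain x x' where x: "x \<in> C" "x \<noteq> 0" "b = x /\<^sub>R norm x"
      and x': "x' \<in> C" "x' \<noteq> 0" "b' = x' /\<^sub>R norm x'"
      using bb by (auto simp: B_def)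
    show ?thesis
    proof (cases "x = x'")
      case True
      then show ?thesis using x x' by (simp add: power2_norm_eq_inner[symmetric] power2_eq_square)
    next
      case False
      then have "x \<bullet> x' = 0"
        using C(3) x x' by (auto simp: pairwise_def orthogonal_def)
      then have "b \<bullet> b' = 0" using x x' by simp
      moreover have "b \<bullet> b \<noteq> 0" using x by simp
      ultimately show ?thesis by auto
    qed
  qed
  ultimately show ?thesis unfolding orthonormal_basis_def by blast
qed

context orthonormal_basis
begin

lemma expansion: "(\<Sum>b\<in>B. (x \<bullet> b) *\<^sub>R b) = x"
proof -
  define y where "y = x - (\<Sum>b\<in>B. (x \<bullet> b) *\<^sub>R b)"
  have "y \<bullet> b = 0" if "b \<in> B" for b
  proof -
    have "(\<Sum>c\<in>B. (x \<bullet> c) * (c \<bullet> b)) = (\<Sum>c\<in>B. if c = b then x \<bullet> b else 0)"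
      using that by (intro sum.cong) (auto simp: inner_B)
    then show ?thesis
      using that by (simp add: y_def inner_diff_left inner_sum_left finite_B)
  qed
  then have "orthogonal y z" if "z \<in> span B" for z
    using that orthogonal_to_span[of z B y] by (auto simp: orthogonal_def)
  then have "y \<bullet> y = 0" using span_B by (auto simp: orthogonal_def)
  then show ?thesis by (simp add: y_def)
qed

lemma linear_expansion:
  assumes "linear f"
  shows "f x = (\<Sum>b\<in>B. (x \<bullet> b) *\<^sub>R f b)"
proof -
  have "f x = f (\<Sum>b\<in>B. (x \<bullet> b) *\<^sub>R b)" by (simp add: expansion)
  then show ?thesis using assms by (simp add: linear_sum linear_scale)
qed

lemma linear_bound:
  assumes "linear f"
  shows "norm (f x) \<le> (\<Sum>b\<in>B. norm (f b)) * norm x"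
proof -
  have 1: "\<bar>x \<bullet> b\<bar> \<le> norm x" if "b \<in> B" for b
  proof -
    have "norm b = 1" using inner_B[OF that that] by (simp add: norm_eq_sqrt_inner)
    then show ?thesis using Cauchy_Schwarz_ineq2[of x b] by simp
  qed
  have "norm (f x) \<le> (\<Sum>b\<in>B. norm ((x \<bullet> b) *\<^sub>R f b))"
    by (subst linear_expansion[OF assms]) (rule norm_sum)
  also have "\<dots> \<le> (\<Sum>b\<in>B. norm x * norm (f b))"
    by (intro sum_mono) (auto intro!: mult_right_mono 1)
  finally show ?thesis by (simp add: sum_distrib_left mult.commute)
qed

lemma linear_injective_surjective:
  fixes f :: "'e \<Rightarrow> 'e"
  assumes "linear f" and "\<And>x. f x = 0 \<Longrightarrow> x = 0"
  shows "surj f"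
proof -
  have nz: "0 \<notin> B" using inner_B[of 0 0] by auto
  have "pairwise orthogonal B" by (auto simp: pairwise_def orthogonal_def inner_B)
  then have "independent B" using nz by (rule pairwise_orthogonal_independent)
  then interpret fd: finite_dimensional_vector_space "(*\<^sub>R)" B
    by unfold_locales (use finite_B span_B in \<open>auto simp: dependent_raw_def span_raw_def\<close>)
  have "inj f" using assms linear_inj_iff_eq_0 by blast
  then show ?thesis using assms(1) fd.linear_inj_imp_surj by (auto simp: linear_def)
qed

text \<open>The map \<open>H\<close> that turns \<open>\<beta> z\<close> into an inner product, \<open>\<beta> z w = H z \<bullet> w\<close>, is injective by nondegeneracy
  and therefore bijective.\<close>

lemma nondegenerate_represents:
  fixes \<beta> :: "'e \<Rightarrow> 'e \<Rightarrow> real"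
  assumes l: "\<And>w. linear (\<lambda>z. \<beta> z w)" and r: "\<And>z. linear (\<beta> z)"
    and nd: "\<And>z. (\<And>w. \<beta> z w = 0) \<Longrightarrow> z = 0" and "linear k"
  shows "\<exists>!z. \<forall>w. \<beta> z w = k w"
proof -
  define H where "H z = (\<Sum>b\<in>B. \<beta> z b *\<^sub>R b)" for z
  have H: "H z \<bullet> w = \<beta> z w" for z w
    using linear_expansion[OF r, of z w]
    by (simp add: H_def inner_sum_left inner_commute[of w] mult.commute)
  have "linear H"
    unfolding H_def
    by (intro linear_compose_sum ballI)
       (auto intro!: linearI simp: linear_add[OF l] linear_scale[OF l] algebra_simps)
  moreover have "z = 0" if "H z = 0" for z
    using H[of z] that by (intro nd) simp
  ultimately have "surj H" by (rule linear_injective_surjective)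
  then obtain z where z: "H z = (\<Sum>b\<in>B. k b *\<^sub>R b)" by (metis surjD)
  have "\<beta> z w = k w" for w
    using linear_expansion[OF \<open>linear k\<close>, of w]
    by (simp add: H[symmetric] z inner_sum_left inner_commute[of w] mult.commute)
  moreover have "z' = z" if "\<forall>w. \<beta> z' w = k w" for z'
  proof -
    have "\<beta> (z' - z) w = 0" for w
      using that calculation by (simp add: linear_diff[OF l])
    then show ?thesis using nd by fastforce
  qed
  ultimately show ?thesis by blast
qed

text \<open>If \<open>G b\<close> represents the functional \<open>w \<mapsto> b \<bullet> w\<close>,
  then \<open>z\<close> is the sum of the vectors \<open>\<beta> z b *\<^sub>R G b\<close>; this gives the constant.\<close>

lemma nondegenerate_bound:
  fixes \<beta> :: "'e \<Rightarrow> 'e \<Rightarrow> real"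
  assumes l: "\<And>w. linear (\<lambda>z. \<beta> z w)" and r: "\<And>z. linear (\<beta> z)"
    and nd: "\<And>z. (\<And>w. \<beta> z w = 0) \<Longrightarrow> z = 0"
  obtains M where "M > 0" "\<And>z. norm z \<le> M * (\<Sum>b\<in>B. \<bar>\<beta> z b\<bar>)"
proof -
  have "\<exists>!z. \<forall>w. \<beta> z w = c \<bullet> w" for c
    by (rule nondegenerate_represents[OF l r nd]) (auto intro: linearI simp: inner_add_right)
  then obtain G where G: "\<beta> (G c) w = c \<bullet> w" for c w by metis
  define M where "M = 1 + (\<Sum>b\<in>B. norm (G b))"
  have pos: "(\<Sum>b\<in>B. norm (G b)) \<ge> 0" by (simp add: sum_nonneg)
  have "norm z \<le> M * (\<Sum>b\<in>B. \<bar>\<beta> z b\<bar>)" for z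
  proof -
    have "z - (\<Sum>b\<in>B. \<beta> z b *\<^sub>R G b) = 0"
    proof (rule nd)
      fix w
      have "\<beta> (z - (\<Sum>b\<in>B. \<beta> z b *\<^sub>R G b)) w = \<beta> z w - (\<Sum>b\<in>B. \<beta> z b * (b \<bullet> w))"
        by (simp add: linear_diff[OF l] linear_sum[OF l] linear_scale[OF l] G)
      also have "(\<Sum>b\<in>B. \<beta> z b * (b \<bullet> w)) = \<beta> z w"
        using linear_expansion[OF r, of z w] by (simp add: inner_commute mult.commute)
      finally show "\<beta> (z - (\<Sum>b\<in>B. \<beta> z b *\<^sub>R G b)) w = 0" by simp
    qed
    then have "norm z = norm (\<Sum>b\<in>B. \<beta> z b *\<^sub>R G b)" by simp
    also have "\<dots> \<le> (\<Sum>b\<in>B. \<bar>\<beta> z b\<bar> * norm (G b))"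
      by (rule order_trans[OF norm_sum]) simp
    also have "\<dots> \<le> (\<Sum>b\<in>B. \<bar>\<beta> z b\<bar> * M)"
    proof (intro sum_mono mult_left_mono)
      fix b assume "b \<in> B"
      then have "norm (G b) \<le> (\<Sum>b\<in>B. norm (G b))"
        using finite_B by (intro member_le_sum) auto
      then show "norm (G b) \<le> M" by (simp add: M_def)
    qed simp
    finally show ?thesis by (simp add: sum_distrib_left mult.commute)
  qed
  moreover have "M > 0" using pos by (simp add: M_def)
  ultimately show ?thesis using that by blast
qed

end

section \<open>Calculus\<close>

text \<open>The set of candidates from which \<open>frechet_derivative\<close> chooses depends only on the germ.\<close>

lemma frechet_derivative_cong_open:
  assumes "open U" "x \<in> U" "\<And>y. y \<in> U \<Longrightarrow> f y = g y"
  shows "frechet_derivative f (at x) = frechet_derivative g (at x)"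
proof -
  have "(f has_derivative D) (at x) \<longleftrightarrow> (g has_derivative D) (at x)" for D
    using has_derivative_transform_within_open[OF _ assms(1,2)] assms(3) by metis
  then show ?thesis by (simp add: frechet_derivative_def)
qed

lemma differentiable_cong_open:
  assumes "f differentiable (at x)" "open U" "x \<in> U" "\<And>y. y \<in> U \<Longrightarrow> f y = g y"
  shows "g differentiable (at x)"
  using assms has_derivative_transform_within_open unfolding differentiable_def by blast

lemma vector_derivative_cong_open:
  assumes "open U" "t \<in> U" "\<And>s. s \<in> U \<Longrightarrow> f s = g s"
  shows "vector_derivative f (at t) = vector_derivative g (at t)"
  using assms by (intro vector_derivative_cong_eq) (auto simp: eventually_nhds)

lemma C_k_on_cong:
  assumes "C_k_on k S f" "open S" "\<And>x. x \<in> S \<Longrightarrow> f x = g x"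
  shows "C_k_on k S g"
  using assms
proof (induction k arbitrary: f g)
  case 0
  then show ?case using continuous_on_cong by fastforce
next
  case (Suc k)
  have "C_k_on k S (\<lambda>x. frechet_derivative g (at x) v)" for v
    by (rule Suc.IH[of "\<lambda>x. frechet_derivative f (at x) v"])
       (use Suc.prems frechet_derivative_cong_open[of S _ f g] in auto)
  then show ?case using Suc.prems differentiable_cong_open[of f _ S g] by auto
qed

lemma C_k_on_subset: "C_k_on k S f \<Longrightarrow> T \<subseteq> S \<Longrightarrow> C_k_on k T f"
  by (induction k arbitrary: f) (auto intro: continuous_on_subset)

text \<open>For gluing: a curve assembled from smooth pieces that overlap in open sets is smooth.\<close>

lemma C_k_on_local:
  assumes "\<And>x. x \<in> S \<Longrightarrow> \<exists>U. open U \<and> x \<in> U \<and> C_k_on k U f"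
  shows "C_k_on k S f"
  using assms
proof (induction k arbitrary: f)
  case 0
  have "isCont f x" if "x \<in> S" for x
    using 0[OF that] by (auto simp: continuous_on_eq_continuous_at)
  then show ?case by (simp add: continuous_at_imp_continuous_on)
next
  case (Suc k)
  have "f differentiable (at x)" if "x \<in> S" for x
    using Suc.prems[OF that] by auto
  moreover have "C_k_on k S (\<lambda>x. frechet_derivative f (at x) v)" for v
  proof (rule Suc.IH)
    fix x assume "x \<in> S"
    from Suc.prems[OF this] show "\<exists>U. open U \<and> x \<in> U \<and> C_k_on k U (\<lambda>x. frechet_derivative f (at x) v)"
      by auto
  qed
  ultimately show ?case by simp
qed

lemma C_k_on_Suc: "C_k_on (Suc k) S f \<Longrightarrow> C_k_on k S f"
proof (induction k arbitrary: f)
  case 0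
  then have "isCont f x" if "x \<in> S" for x
    using that differentiable_imp_continuous_within by auto
  then show ?case by (simp add: continuous_at_imp_continuous_on)
qed auto

lemma C_k_on_SucI:
  assumes "open S" and d: "\<And>x. x \<in> S \<Longrightarrow> (f has_derivative f' x) (at x)"
    and C: "\<And>v. C_k_on k S (\<lambda>x. f' x v)"
  shows "C_k_on (Suc k) S f"
proof -
  have "f' x v = frechet_derivative f (at x) v" if "x \<in> S" for x v
    using frechet_derivative_at[OF d[OF that]] by simp
  then have "C_k_on k S (\<lambda>x. frechet_derivative f (at x) v)" for v
    by (rule C_k_on_cong[OF C[of v] \<open>open S\<close>])
  then show ?thesis using d by (auto simp: differentiable_def)
qed

lemma C_k_on_bounded_linear:
  assumes "bounded_linear L" "C_k_on k S f" "open S"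
  shows "C_k_on k S (\<lambda>x. L (f x))"
  using assms(2)
proof (induction k arbitrary: f)
  case 0
  then show ?case using bounded_linear.continuous_on[OF assms(1)] by auto
next
  case (Suc k)
  have d: "((\<lambda>x. L (f x)) has_derivative (\<lambda>v. L (frechet_derivative f (at x) v))) (at x)"
    if "x \<in> S" for x
    using that Suc.prems
    by (intro bounded_linear.has_derivative[OF assms(1)]) (auto simp: frechet_derivative_works)
  show ?case using Suc by (intro C_k_on_SucI[OF \<open>open S\<close> d]) auto
qed

lemma C_k_on_add:
  assumes "C_k_on k S f" "C_k_on k S g" "open S"
  shows "C_k_on k S (\<lambda>x. f x + g x)"
  using assms(1,2)
proof (induction k arbitrary: f g)
  case 0
  then show ?case by (auto intro: continuous_intros)
next
  case (Suc k)
  have d: "((\<lambda>x. f x + g x) has_derivative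
      (\<lambda>v. frechet_derivative f (at x) v + frechet_derivative g (at x) v)) (at x)"
    if "x \<in> S" for x
    using that Suc.prems by (intro has_derivative_add) (auto simp: frechet_derivative_works)
  show ?case using Suc by (intro C_k_on_SucI[OF \<open>open S\<close> d]) auto
qed

lemma C_k_on_const: "C_k_on k S (\<lambda>x. c)"
  by (induction k arbitrary: c) auto

lemma C_k_on_sum:
  assumes "\<And>i. i \<in> I \<Longrightarrow> C_k_on k S (f i)" "open S"
  shows "C_k_on k S (\<lambda>x. \<Sum>i\<in>I. f i x)"
  using assms(1)
proof (induction I rule: infinite_finite_induct)
  case (insert i I)
  then show ?case using C_k_on_add[OF _ _ assms(2)] by auto
qed (simp_all add: C_k_on_const)

lemma C_k_on_scaleR:
  fixes f :: "'a::real_normed_vector \<Rightarrow> real"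
  assumes "C_k_on k S f" "C_k_on k S g" "open S"
  shows "C_k_on k S (\<lambda>x. f x *\<^sub>R g x)"
  using assms(1,2)
proof (induction k arbitrary: f g)
  case 0
  then show ?case by (auto intro: continuous_intros)
next
  case (Suc k)
  have d: "((\<lambda>x. f x *\<^sub>R g x) has_derivative
      (\<lambda>v. f x *\<^sub>R frechet_derivative g (at x) v + frechet_derivative f (at x) v *\<^sub>R g x)) (at x)"
    if "x \<in> S" for x
    using that Suc.prems by (intro has_derivative_scaleR) (auto simp: frechet_derivative_works)
  show ?case
    using Suc.prems C_k_on_Suc[OF Suc.prems(1)] C_k_on_Suc[OF Suc.prems(2)]
    by (intro C_k_on_SucI[OF \<open>open S\<close> d] C_k_on_add \<open>open S\<close> Suc.IH) auto
qed

lemma smooth_on_differentiable: "smooth_on S f \<Longrightarrow> x \<in> S \<Longrightarrow> f differentiable (at x)"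
  unfolding smooth_on_def using C_k_on.simps(2) by blast

lemma smooth_on_derivative:
  "smooth_on S f \<Longrightarrow> smooth_on S (\<lambda>x. frechet_derivative f (at x) v)"
  unfolding smooth_on_def using C_k_on.simps(2) by blast

lemma smooth_on_subset: "smooth_on S f \<Longrightarrow> T \<subseteq> S \<Longrightarrow> smooth_on T f"
  unfolding smooth_on_def using C_k_on_subset by blast

lemma smooth_on_continuous: "smooth_on S f \<Longrightarrow> continuous_on S f"
  unfolding smooth_on_def using C_k_on.simps(1) by blast

text \<open>In coordinates the chain rule writes the directional derivative of \<open>F (y t)\<close> as a finite sum of
  products of a component of \<open>y'\<close> with a partial derivative of \<open>F\<close> along \<open>y\<close>; the induction applies to
  the latter because the partial derivatives of a smooth map are again smooth.\<close>

lemma (in orthonormal_basis) C_k_on_compose: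
  fixes F :: "'e \<Rightarrow> 'f::real_normed_vector"
  assumes "open J" "open S" "y ` J \<subseteq> S" "smooth_on S F" "C_k_on k J y"
  shows "C_k_on k J (\<lambda>t. F (y t))"
  using assms(4,5)
proof (induction k arbitrary: F)
  case 0
  then show ?case
    using assms(3) by (auto intro: continuous_on_compose2[OF smooth_on_continuous])
next
  case (Suc k)
  have ys: "y t \<in> S" if "t \<in> J" for t using that assms(3) by auto
  have "((\<lambda>t. F (y t)) has_derivative (\<lambda>v. \<Sum>b\<in>B. (frechet_derivative y (at t) v \<bullet> b) *\<^sub>R
      frechet_derivative F (at (y t)) b)) (at t)" if "t \<in> J" for t
  proof -
    have dF: "F differentiable (at (y t))"
      by (rule smooth_on_differentiable[OF Suc.prems(1) ys[OF that]])
    have "((\<lambda>t. F (y t)) has_derivative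
        (\<lambda>v. frechet_derivative F (at (y t)) (frechet_derivative y (at t) v))) (at t)"
      using that Suc.prems dF
      by (rule_tac has_derivative_compose[of y]) (auto simp: frechet_derivative_works[symmetric])
    then show ?thesis by (simp add: linear_expansion[OF linear_frechet_derivative[OF dF], symmetric])
  qed
  moreover have "C_k_on k J
      (\<lambda>t. \<Sum>b\<in>B. (frechet_derivative y (at t) v \<bullet> b) *\<^sub>R frechet_derivative F (at (y t)) b)" for v
  proof (intro C_k_on_sum C_k_on_scaleR \<open>open J\<close>)
    fix b
    show "C_k_on k J (\<lambda>t. frechet_derivative y (at t) v \<bullet> b)"
      using Suc.prems by (intro C_k_on_bounded_linear[OF bounded_linear_inner_left _ \<open>open J\<close>]) auto
    show "C_k_on k J (\<lambda>t. frechet_derivative F (at (y t)) b)"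
      by (intro Suc.IH smooth_on_derivative Suc.prems C_k_on_Suc)
  qed
  ultimately show ?case by (rule C_k_on_SucI[OF \<open>open J\<close>])
qed

lemma C_k_on_reflect:
  fixes y :: "real \<Rightarrow> 'e::real_normed_vector"
  assumes "open J" "smooth_on J y"
  shows "C_k_on k ((\<lambda>s. a - s) -` J) (\<lambda>s. y (a - s))"
proof -
  \<comment> \<open>The real line is itself a model space, so the composition lemma applies to \<open>y\<close> after an affine map.\<close>
  interpret R: orthonormal_basis "{1::real}"
    by unfold_locales (use real_scaleR_def in \<open>auto simp: span_singleton\<close>)
  have o: "open ((\<lambda>s. a - s) -` J)" by (intro open_vimage assms continuous_intros)
  have "C_k_on k ((\<lambda>s. a - s) -` J) (\<lambda>s. a - s)"
  proof (cases k)
    case (Suc m)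
    have "((\<lambda>s. a - s) has_derivative (\<lambda>v. - v)) (at s)" for s
      by (auto intro!: derivative_eq_intros)
    then show ?thesis unfolding Suc by (rule C_k_on_SucI[OF o]) (rule C_k_on_const)
  qed (auto intro: continuous_intros)
  then show ?thesis by (intro R.C_k_on_compose[OF o assms(1) _ assms(2)]) auto
qed

lemma has_real_derivative_along_line:
  fixes f :: "'a::real_normed_vector \<Rightarrow> real"
  assumes "f differentiable (at (p + a *\<^sub>R u))"
  shows "((\<lambda>a. f (p + a *\<^sub>R u)) has_real_derivative frechet_derivative f (at (p + a *\<^sub>R u)) u) (at a)"
proof -
  have "((\<lambda>a. p + a *\<^sub>R u) has_derivative (\<lambda>a. a *\<^sub>R u)) (at a)"
    by (auto intro!: derivative_eq_intros)
  then have "((\<lambda>a. f (p + a *\<^sub>R u)) has_derivative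
      (\<lambda>k. frechet_derivative f (at (p + a *\<^sub>R u)) (k *\<^sub>R u))) (at a)"
    using assms by (rule_tac has_derivative_compose[of "\<lambda>a. p + a *\<^sub>R u"])
      (auto simp: frechet_derivative_works[symmetric])
  moreover have "linear (frechet_derivative f (at (p + a *\<^sub>R u)))"
    using assms by (rule linear_frechet_derivative)
  ultimately show ?thesis
    by (simp add: has_field_derivative_def linear_scale mult_commute_abs)
qed

text \<open>Both mixed partial derivatives are limits of the second difference quotient
  \<open>(f (x + su + sv) - f (x + su) - f (x + sv) + f x) / s\<^sup>2\<close>, by two applications of the mean
  value theorem, and that quotient is symmetric in \<open>u\<close> and \<open>v\<close>.\<close>

lemma second_difference_quotient:
  fixes f :: "'a::real_normed_vector \<Rightarrow> real"
  assumes "open S" "x \<in> S" "C_k_on 2 S f" "\<epsilon> > 0"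
  shows "\<exists>\<delta>>0. \<forall>s. 0 < s \<and> s < \<delta> \<longrightarrow>
    \<bar>(f (x + s *\<^sub>R u + s *\<^sub>R v) - f (x + s *\<^sub>R u) - f (x + s *\<^sub>R v) + f x) / s\<^sup>2
      - frechet_derivative (\<lambda>y. frechet_derivative f (at y) u) (at x) v\<bar> < \<epsilon>"
proof -
  let ?D = "\<lambda>y. frechet_derivative f (at y) u"
  let ?E = "\<lambda>y. frechet_derivative ?D (at y) v"
  have 2: "C_k_on (Suc (Suc 0)) S f" using assms(3) by (simp add: numeral_2_eq_2)
  then have df: "f differentiable (at y)" and dD: "?D differentiable (at y)" if "y \<in> S" for y
    using that by auto
  have "continuous_on S ?E" using 2 by auto
  then have "isCont ?E x" using assms continuous_on_eq_continuous_at by blast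
  then obtain r1 where r1: "r1 > 0" "\<And>y. dist y x < r1 \<Longrightarrow> \<bar>?E y - ?E x\<bar> < \<epsilon>"
    using \<open>\<epsilon> > 0\<close> unfolding continuous_at_eps_delta by (metis dist_real_def)
  obtain r2 where r2: "r2 > 0" "ball x r2 \<subseteq> S" using assms(1,2) openE by blast
  define r where "r = min r1 r2"
  \<comment> \<open>For \<open>s < \<delta>\<close> the whole parallelogram spanned by \<open>su\<close> and \<open>sv\<close> lies in the ball of radius \<open>r\<close>.\<close>
  define \<delta> where "\<delta> = r / (norm u + norm v + 1)"
  have N: "norm u + norm v + 1 > 0" by (smt (verit) norm_ge_zero)
  have "\<delta> > 0" using r1 r2 N by (simp add: \<delta>_def r_def)
  moreover have "\<bar>(f (x + s *\<^sub>R u + s *\<^sub>R v) - f (x + s *\<^sub>R u) - f (x + s *\<^sub>R v) + f x) / s\<^sup>2 - ?E x\<bar> < \<epsilon>"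
    if s: "0 < s" "s < \<delta>" for s
  proof -
    have near: "dist (x + a *\<^sub>R u + b *\<^sub>R v) x < r" if "0 \<le> a" "a \<le> s" "0 \<le> b" "b \<le> s" for a b
    proof -
      have "dist (x + a *\<^sub>R u + b *\<^sub>R v) x \<le> a * norm u + b * norm v"
        using that norm_triangle_ineq[of "a *\<^sub>R u" "b *\<^sub>R v"] by (simp add: dist_norm)
      also have "\<dots> \<le> s * norm u + s * norm v"
        using that by (intro add_mono mult_right_mono) auto
      also have "\<dots> < s * (norm u + norm v + 1)" using s by (simp add: algebra_simps)
      also have "\<dots> < r" using s N by (simp add: \<delta>_def field_simps)
      finally show ?thesis .
    qed
    then have inS: "x + a *\<^sub>R u + b *\<^sub>R v \<in> S" if "0 \<le> a" "a \<le> s" "0 \<le> b" "b \<le> s" for a b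
      using that r2(2) by (force simp: r_def dist_commute)
    have "\<exists>a>0. a < s \<and>
        (f (x + s *\<^sub>R v + s *\<^sub>R u) - f (x + s *\<^sub>R u)) - (f (x + s *\<^sub>R v + 0 *\<^sub>R u) - f (x + 0 *\<^sub>R u))
        = (s - 0) * (?D (x + s *\<^sub>R v + a *\<^sub>R u) - ?D (x + a *\<^sub>R u))"
    proof (rule MVT2[OF s(1)])
      fix a assume a: "0 \<le> a" "a \<le> s"
      show "((\<lambda>a. f (x + s *\<^sub>R v + a *\<^sub>R u) - f (x + a *\<^sub>R u)) has_real_derivative
          ?D (x + s *\<^sub>R v + a *\<^sub>R u) - ?D (x + a *\<^sub>R u)) (at a)"
        using inS[of a s] inS[of a 0] a s
        by (intro DERIV_diff has_real_derivative_along_line df) (auto simp: algebra_simps)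
    qed
    then obtain a where a: "0 < a" "a < s"
      "f (x + s *\<^sub>R u + s *\<^sub>R v) - f (x + s *\<^sub>R u) - f (x + s *\<^sub>R v) + f x
        = s * (?D (x + s *\<^sub>R v + a *\<^sub>R u) - ?D (x + a *\<^sub>R u))"
      by (auto simp: add.commute add.left_commute algebra_simps)
    have "\<exists>b>0. b < s \<and> ?D (x + a *\<^sub>R u + s *\<^sub>R v) - ?D (x + a *\<^sub>R u + 0 *\<^sub>R v)
        = (s - 0) * ?E (x + a *\<^sub>R u + b *\<^sub>R v)"
    proof (rule MVT2[OF s(1)])
      fix b assume "0 \<le> b" "b \<le> s"
      then show "((\<lambda>b. ?D (x + a *\<^sub>R u + b *\<^sub>R v)) has_real_derivative ?E (x + a *\<^sub>R u + b *\<^sub>R v)) (at b)"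
        using inS[of a b] a s by (intro has_real_derivative_along_line dD) auto
    qed
    then obtain b where b: "0 < b" "b < s"
      "?D (x + s *\<^sub>R v + a *\<^sub>R u) - ?D (x + a *\<^sub>R u) = s * ?E (x + a *\<^sub>R u + b *\<^sub>R v)"
      by (auto simp: algebra_simps)
    have "(f (x + s *\<^sub>R u + s *\<^sub>R v) - f (x + s *\<^sub>R u) - f (x + s *\<^sub>R v) + f x) / s\<^sup>2
        = ?E (x + a *\<^sub>R u + b *\<^sub>R v)"
      using s by (simp add: a(3) b(3) power2_eq_square)
    then show ?thesis
      using r1(2)[OF less_le_trans[OF near[of a b]]] a b by (simp add: r_def)
  qed
  ultimately show ?thesis by blast
qed

lemma second_derivative_symmetric_real:
  fixes f :: "'a::real_normed_vector \<Rightarrow> real"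
  assumes "open S" "x \<in> S" "C_k_on 2 S f"
  shows "frechet_derivative (\<lambda>y. frechet_derivative f (at y) u) (at x) v
    = frechet_derivative (\<lambda>y. frechet_derivative f (at y) v) (at x) u" (is "?P = ?Q")
proof (rule ccontr)
  assume "?P \<noteq> ?Q"
  then have e: "\<bar>?P - ?Q\<bar> / 2 > 0" by simp
  let ?q = "\<lambda>s. (f (x + s *\<^sub>R u + s *\<^sub>R v) - f (x + s *\<^sub>R u) - f (x + s *\<^sub>R v) + f x) / s\<^sup>2"
  obtain \<delta>1 where 1: "\<delta>1 > 0" "\<And>s. 0 < s \<Longrightarrow> s < \<delta>1 \<Longrightarrow> \<bar>?q s - ?P\<bar> < \<bar>?P - ?Q\<bar> / 2"
    using second_difference_quotient[OF assms e, of u v] by blast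
  obtain \<delta>2 where 2: "\<delta>2 > 0" "\<And>s. 0 < s \<Longrightarrow> s < \<delta>2 \<Longrightarrow>
    \<bar>(f (x + s *\<^sub>R v + s *\<^sub>R u) - f (x + s *\<^sub>R v) - f (x + s *\<^sub>R u) + f x) / s\<^sup>2 - ?Q\<bar> < \<bar>?P - ?Q\<bar> / 2"
    using second_difference_quotient[OF assms e, of v u] by blast
  define s where "s = min \<delta>1 \<delta>2 / 2"
  have s: "0 < s" "s < \<delta>1" "s < \<delta>2" using 1(1) 2(1) by (auto simp: s_def)
  have "(f (x + s *\<^sub>R v + s *\<^sub>R u) - f (x + s *\<^sub>R v) - f (x + s *\<^sub>R u) + f x) / s\<^sup>2 = ?q s"
    by (simp add: algebra_simps)
  moreover have False if "q' = q" "\<bar>q - P\<bar> < \<bar>P - Q\<bar> / 2" "\<bar>q' - Q\<bar> < \<bar>P - Q\<bar> / 2" for q q' P Q :: real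
  proof -
    have "\<bar>P - Q\<bar> \<le> \<bar>q - P\<bar> + \<bar>q - Q\<bar>" by linarith
    then show False using that by simp
  qed
  ultimately show False using 1(2)[OF s(1,2)] 2(2)[OF s(1,3)] by blast
qed

lemma second_derivative_symmetric:
  fixes f :: "'a::real_normed_vector \<Rightarrow> 'b::real_inner"
  assumes "open S" "x \<in> S" "C_k_on 2 S f"
  shows "frechet_derivative (\<lambda>y. frechet_derivative f (at y) u) (at x) v
    = frechet_derivative (\<lambda>y. frechet_derivative f (at y) v) (at x) u"
proof -
  have 2: "C_k_on (Suc (Suc 0)) S f" using assms(3) by (simp add: numeral_2_eq_2)
  have D1: "frechet_derivative (\<lambda>z. g z \<bullet> w) (at y) k = frechet_derivative g (at y) k \<bullet> w"
    if "g differentiable (at y)" for g :: "'a \<Rightarrow> 'b" and y k w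
  proof -
    have "((\<lambda>z. g z \<bullet> w) has_derivative (\<lambda>k. frechet_derivative g (at y) k \<bullet> w)) (at y)"
      using that by (intro has_derivative_inner_left) (auto simp: frechet_derivative_works)
    then show ?thesis using frechet_derivative_at by metis
  qed
  have D2: "frechet_derivative (\<lambda>y. frechet_derivative (\<lambda>z. f z \<bullet> w) (at y) k) (at x) l
      = frechet_derivative (\<lambda>y. frechet_derivative f (at y) k) (at x) l \<bullet> w" for w k l
  proof -
    have "frechet_derivative (\<lambda>y. frechet_derivative (\<lambda>z. f z \<bullet> w) (at y) k) (at x)
        = frechet_derivative (\<lambda>y. frechet_derivative f (at y) k \<bullet> w) (at x)"
      using 2 by (intro frechet_derivative_cong_open[OF assms(1,2)] D1) auto
    then show ?thesis using 2 assms(2) by (simp add: D1)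
  qed
  have "C_k_on 2 S (\<lambda>z. f z \<bullet> w)" for w
    by (rule C_k_on_bounded_linear[OF bounded_linear_inner_left assms(3,1)])
  from second_derivative_symmetric_real[OF assms(1,2) this, of _ u v]
  show ?thesis unfolding D2 using vector_eq_rdot by blast
qed

text \<open>The product rule for a family of linear maps \<open>T z\<close> applied to a moving vector \<open>a z\<close>;
  only the derivatives of \<open>T z v\<close> for fixed \<open>v\<close> have to be known.\<close>

lemma (in orthonormal_basis) has_derivative_linear_family:
  fixes T :: "'x::real_normed_vector \<Rightarrow> 'e \<Rightarrow> 'f::real_normed_vector"
  assumes "open S" "x \<in> S" and lin: "\<And>z. z \<in> S \<Longrightarrow> linear (T z)"
    and dT: "\<And>v. ((\<lambda>z. T z v) has_derivative T' v) (at x)"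
    and da: "(a has_derivative a') (at x)"
  shows "((\<lambda>z. T z (a z)) has_derivative (\<lambda>k. T' (a x) k + T x (a' k))) (at x)"
proof -
  have lx: "linear (T x)" by (rule lin[OF \<open>x \<in> S\<close>])
  have "((\<lambda>z. \<Sum>b\<in>B. (a x \<bullet> b) *\<^sub>R T z b) has_derivative (\<lambda>k. \<Sum>b\<in>B. (a x \<bullet> b) *\<^sub>R T' b k)) (at x)"
    by (intro has_derivative_sum has_derivative_scaleR_right dT)
  then have "((\<lambda>z. T z (a x)) has_derivative (\<lambda>k. \<Sum>b\<in>B. (a x \<bullet> b) *\<^sub>R T' b k)) (at x)"
    by (rule has_derivative_transform_within_open[OF _ assms(1,2)])
       (simp add: linear_expansion[OF lin, symmetric])
  then have T': "T' (a x) = (\<lambda>k. \<Sum>b\<in>B. (a x \<bullet> b) *\<^sub>R T' b k)"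
    using dT has_derivative_unique by blast
  have "((\<lambda>z. \<Sum>b\<in>B. (a z \<bullet> b) *\<^sub>R T z b) has_derivative
      (\<lambda>k. \<Sum>b\<in>B. (a x \<bullet> b) *\<^sub>R T' b k + (a' k \<bullet> b) *\<^sub>R T x b)) (at x)"
    by (intro has_derivative_sum has_derivative_scaleR has_derivative_inner_left da dT)
  then have "((\<lambda>z. T z (a z)) has_derivative
      (\<lambda>k. \<Sum>b\<in>B. (a x \<bullet> b) *\<^sub>R T' b k + (a' k \<bullet> b) *\<^sub>R T x b)) (at x)"
    by (rule has_derivative_transform_within_open[OF _ assms(1,2)])
       (simp add: linear_expansion[OF lin, symmetric])
  then show ?thesis
    by (simp add: T' sum.distrib linear_expansion[OF lx, symmetric])
qed

section \<open>Locally Lipschitz functions and second-order differential inequalities\<close>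

definition lipschitz_near :: "('x::metric_space \<Rightarrow> real) \<Rightarrow> 'x \<Rightarrow> bool" where
  "lipschitz_near f z \<longleftrightarrow> (\<exists>U K. open U \<and> z \<in> U \<and> K-lipschitz_on U f)"

lemma lipschitz_near_cong:
  assumes "lipschitz_near f z" "open U" "z \<in> U" "\<And>p. p \<in> U \<Longrightarrow> f p = g p"
  shows "lipschitz_near g z"
proof -
  obtain V K where V: "open V" "z \<in> V" "K-lipschitz_on V f"
    using assms(1) by (auto simp: lipschitz_near_def)
  then have "K-lipschitz_on (U \<inter> V) f" by (auto intro: lipschitz_on_subset)
  then have "K-lipschitz_on (U \<inter> V) g" using assms(4) by (simp add: lipschitz_on_def)
  then show ?thesis using V assms(2,3) unfolding lipschitz_near_def by blast
qed

lemma lipschitz_near_const: "lipschitz_near (\<lambda>p. c) z"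
  unfolding lipschitz_near_def by (rule exI[of _ UNIV], rule exI[of _ 0]) (simp add: lipschitz_on_def)

lemma lipschitz_near_add:
  assumes "lipschitz_near f z" "lipschitz_near g z"
  shows "lipschitz_near (\<lambda>p. f p + g p) z"
proof -
  obtain U K V L where *: "open U" "z \<in> U" "K-lipschitz_on U f" "open V" "z \<in> V" "L-lipschitz_on V g"
    using assms by (auto simp: lipschitz_near_def)
  then have "(K + L)-lipschitz_on (U \<inter> V) (\<lambda>p. f p + g p)"
    by (intro lipschitz_on_add) (auto intro: lipschitz_on_subset)
  then show ?thesis using * unfolding lipschitz_near_def by blast
qed

lemma lipschitz_near_sum:
  "(\<And>i. i \<in> I \<Longrightarrow> lipschitz_near (f i) z) \<Longrightarrow> lipschitz_near (\<lambda>p. \<Sum>i\<in>I. f i p) z"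
  by (induction I rule: infinite_finite_induct) (auto simp: lipschitz_near_const intro: lipschitz_near_add)

lemma lipschitz_near_mult:
  assumes "lipschitz_near f z" "lipschitz_near g z"
  shows "lipschitz_near (\<lambda>p. f p * g p) z"
proof -
  obtain U K V L where *: "open U" "z \<in> U" "K-lipschitz_on U f" "open V" "z \<in> V" "L-lipschitz_on V g"
    using assms by (auto simp: lipschitz_near_def)
  define W where "W = U \<inter> V \<inter> ball z 1"
  have K: "K \<ge> 0" and L: "L \<ge> 0" using * lipschitz_on_nonneg by blast+
  have f: "dist (f p) (f q) \<le> K * dist p q" and g: "dist (g p) (g q) \<le> L * dist p q"
    if "p \<in> W" "q \<in> W" for p q
    using that * by (auto simp: W_def intro: lipschitz_onD)
  have z: "z \<in> W" using * by (simp add: W_def)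
  have bf: "\<bar>f p\<bar> \<le> \<bar>f z\<bar> + K" and bg: "\<bar>g p\<bar> \<le> \<bar>g z\<bar> + L" if "p \<in> W" for p
  proof -
    have 1: "dist p z \<le> 1" using that by (simp add: W_def dist_commute)
    show "\<bar>f p\<bar> \<le> \<bar>f z\<bar> + K"
      using f[OF that z] mult_left_mono[OF 1 K] by (simp add: dist_real_def)
    show "\<bar>g p\<bar> \<le> \<bar>g z\<bar> + L"
      using g[OF that z] mult_left_mono[OF 1 L] by (simp add: dist_real_def)
  qed
  have "((\<bar>f z\<bar> + K) * L + (\<bar>g z\<bar> + L) * K)-lipschitz_on W (\<lambda>p. f p * g p)"
  proof (rule lipschitz_onI)
    fix p q assume pq: "p \<in> W" "q \<in> W"
    have "f p * g p - f q * g q = f p * (g p - g q) + g q * (f p - f q)"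
      by (simp add: algebra_simps)
    then have "\<bar>f p * g p - f q * g q\<bar> \<le> \<bar>f p\<bar> * \<bar>g p - g q\<bar> + \<bar>g q\<bar> * \<bar>f p - f q\<bar>"
      by (metis abs_mult abs_triangle_ineq)
    also have "\<dots> \<le> (\<bar>f z\<bar> + K) * (L * dist p q) + (\<bar>g z\<bar> + L) * (K * dist p q)"
      using bf[OF pq(1)] bg[OF pq(2)] f[OF pq] g[OF pq] K L
      by (intro add_mono mult_mono) (simp_all add: dist_real_def)
    finally show "dist (f p * g p) (f q * g q) \<le> ((\<bar>f z\<bar> + K) * L + (\<bar>g z\<bar> + L) * K) * dist p q"
      by (simp add: dist_real_def algebra_simps)
  qed (use K L in auto)
  moreover have "open W" using * by (auto simp: W_def)
  ultimately show ?thesis using z unfolding lipschitz_near_def by blast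
qed

lemma lipschitz_near_bounded_linear: 
  fixes f :: "'x::real_normed_vector \<Rightarrow> real"
  assumes "bounded_linear f"
  shows "lipschitz_near f z"
proof -
  obtain C where "C-lipschitz_on UNIV f" using bounded_linear.lipschitz_boundE[OF assms] by blast
  then show ?thesis unfolding lipschitz_near_def by blast
qed

lemma lipschitz_near_fst:
  fixes p :: "'x::metric_space \<times> 'y::metric_space"
  assumes "lipschitz_near f (fst p)"
  shows "lipschitz_near (\<lambda>p. f (fst p)) p"
proof -
  obtain U K where U: "open U" "fst p \<in> U" "K-lipschitz_on U f"
    using assms by (auto simp: lipschitz_near_def)
  have "K-lipschitz_on (U \<times> UNIV) (\<lambda>p :: 'x \<times> 'y. f (fst p))"
  proof (rule lipschitz_onI)
    show "K \<ge> 0" using U lipschitz_on_nonneg by blast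
    fix p q :: "'x \<times> 'y" assume "p \<in> U \<times> UNIV" "q \<in> U \<times> UNIV"
    then have "dist (f (fst p)) (f (fst q)) \<le> K * dist (fst p) (fst q)"
      using U by (auto intro: lipschitz_onD)
    also have "\<dots> \<le> K * dist p q" using \<open>K \<ge> 0\<close> by (intro mult_left_mono dist_fst_le)
    finally show "dist (f (fst p)) (f (fst q)) \<le> K * dist p q" .
  qed
  moreover have "open (U \<times> (UNIV :: 'y set))" using U by (simp add: open_Times)
  moreover have "p \<in> U \<times> UNIV" using U by (cases p) auto
  ultimately show ?thesis unfolding lipschitz_near_def by blast
qed

text \<open>On a small ball the partial derivatives are bounded by continuity, and the mean value inequality
  applies because a ball is convex.\<close>

lemma (in orthonormal_basis) C_1_lipschitz_near:
  fixes f :: "'e \<Rightarrow> real"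
  assumes "open S" "x \<in> S" "C_k_on 1 S f"
  shows "lipschitz_near f x"
proof -
  let ?D = "\<lambda>x b. frechet_derivative f (at x) b"
  have f: "C_k_on (Suc 0) S f" using assms(3) by simp
  then have df: "f differentiable (at y)" if "y \<in> S" for y using that by auto
  define N where "N y = (\<Sum>b\<in>B. norm (?D y b))" for y
  have "continuous_on S N" unfolding N_def using f by (auto intro!: continuous_intros)
  then have "isCont N x" using assms continuous_on_eq_continuous_at by blast
  then obtain r1 where r1: "r1 > 0" "\<And>y. dist y x < r1 \<Longrightarrow> \<bar>N y - N x\<bar> < 1"
    unfolding continuous_at_eps_delta by (metis dist_real_def zero_less_one)
  obtain r2 where r2: "r2 > 0" "ball x r2 \<subseteq> S" using assms(1,2) openE by blast
  define U where "U = ball x (min r1 r2)"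
  have "N x \<ge> 0" by (simp add: N_def sum_nonneg)
  have "(N x + 1)-lipschitz_on U f"
  proof (rule lipschitz_onI)
    fix p q assume "p \<in> U" "q \<in> U"
    have "norm (f p - f q) \<le> (N x + 1) * norm (p - q)"
    proof (rule differentiable_bound[of U f ?D])
      show "convex U" by (simp add: U_def)
      fix y assume y: "y \<in> U"
      then have "y \<in> S" using r2 by (auto simp: U_def)
      then show "(f has_derivative ?D y) (at y within U)"
        using df frechet_derivative_works has_derivative_at_withinI by blast
      have "N y \<le> N x + 1" using r1(2)[of y] y by (auto simp: U_def dist_commute)
      then have "N y * norm k \<le> (N x + 1) * norm k" for k :: 'e by (rule mult_right_mono) simp
      then have "norm (?D y k) \<le> (N x + 1) * norm k" for k
        using linear_bound[OF linear_frechet_derivative[OF df[OF \<open>y \<in> S\<close>]], of k]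
        unfolding N_def by (rule order_trans[rotated])
      then show "onorm (?D y) \<le> N x + 1" using \<open>N x \<ge> 0\<close> by (intro onorm_bound) auto
    qed fact+
    then show "dist (f p) (f q) \<le> (N x + 1) * dist p q" by (simp add: dist_norm)
  qed (use \<open>N x \<ge> 0\<close> in simp)
  moreover have "open U" "x \<in> U" using r1 r2 by (auto simp: U_def)
  ultimately show ?thesis unfolding lipschitz_near_def by blast
qed

text \<open>A second-order Gronwall lemma: the energy \<open>E = \<bar>d\<bar>\<^sup>2 + \<bar>d'\<bar>\<^sup>2\<close> satisfies
  \<open>\<bar>E'\<bar> \<le> (1 + 3K) E\<close>, so that \<open>E\<close> times an exponential is monotone on either side of
  \<open>t0\<close>.\<close>

lemma second_order_gronwall:
  fixes d d' d'' :: "real \<Rightarrow> 'a::real_inner"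
  assumes d: "\<And>t. \<bar>t - t0\<bar> < r \<Longrightarrow> (d has_vector_derivative d' t) (at t)"
    and d': "\<And>t. \<bar>t - t0\<bar> < r \<Longrightarrow> (d' has_vector_derivative d'' t) (at t)"
    and bound: "\<And>t. \<bar>t - t0\<bar> < r \<Longrightarrow> norm (d'' t) \<le> K * (norm (d t) + norm (d' t))"
    and "K \<ge> 0" "d t0 = 0" "d' t0 = 0" and t: "\<bar>t - t0\<bar> < r"
  shows "d t = 0"
proof -
  define E where "E t = d t \<bullet> d t + d' t \<bullet> d' t" for t
  define E' where "E' t = 2 * (d t \<bullet> d' t) + 2 * (d' t \<bullet> d'' t)" for t
  define C where "C = 1 + 3 * K"
  have E: "(E has_real_derivative E' t) (at t)" if "\<bar>t - t0\<bar> < r" for t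
  proof -
    have "(E has_vector_derivative ((d t \<bullet> d' t + d' t \<bullet> d t) + (d' t \<bullet> d'' t + d'' t \<bullet> d' t))) (at t)"
      using bounded_bilinear.has_vector_derivative[OF bounded_bilinear_inner d[OF that] d[OF that]]
        bounded_bilinear.has_vector_derivative[OF bounded_bilinear_inner d'[OF that] d'[OF that]]
      unfolding E_def by (rule has_vector_derivative_add)
    then show ?thesis
      by (simp add: has_real_derivative_iff_has_vector_derivative E'_def inner_commute)
  qed
  have E'_bound: "\<bar>E' t\<bar> \<le> C * E t" if "\<bar>t - t0\<bar> < r" for t
  proof -
    have p: "2 * (norm (d t) * norm (d' t)) \<le> E t"
      using sum_squares_bound[of "norm (d t)" "norm (d' t)"]
      by (simp add: E_def power2_norm_eq_inner)
    have q: "norm (d' t) * norm (d' t) \<le> E t"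
      by (simp add: E_def power2_norm_eq_inner[symmetric] power2_eq_square)
    have "\<bar>E' t\<bar> \<le> 2 * \<bar>d t \<bullet> d' t\<bar> + 2 * \<bar>d' t \<bullet> d'' t\<bar>"
      by (simp add: E'_def abs_if)
    also have "\<dots> \<le> 2 * (norm (d t) * norm (d' t)) + 2 * (norm (d' t) * norm (d'' t))"
      by (intro add_mono mult_left_mono Cauchy_Schwarz_ineq2) auto
    also have "\<dots> \<le> 2 * (norm (d t) * norm (d' t)) + 2 * (norm (d' t) * (K * (norm (d t) + norm (d' t))))"
      using bound[OF that] by (intro add_mono mult_left_mono) auto
    also have "\<dots> = 2 * (norm (d t) * norm (d' t)) + K * (2 * (norm (d t) * norm (d' t)))
        + 2 * (K * (norm (d' t) * norm (d' t)))"
      by (simp add: algebra_simps)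
    also have "\<dots> \<le> E t + K * E t + 2 * (K * E t)"
      using p q \<open>K \<ge> 0\<close> by (intro add_mono mult_left_mono) auto
    finally show ?thesis by (simp add: C_def algebra_simps)
  qed
  have E0: "E t0 = 0" using assms by (simp add: E_def)
  have "E t \<le> 0"
  proof (cases "t \<ge> t0")
    case True
    have "E t * exp (- C * (t - t0)) \<le> E t0 * exp (- C * (t0 - t0))"
    proof (rule DERIV_nonpos_imp_nonincreasing[OF True])
      fix s assume s: "t0 \<le> s" "s \<le> t"
      then have s': "\<bar>s - t0\<bar> < r" using t by auto
      have "((\<lambda>s. E s * exp (- C * (s - t0))) has_real_derivative
          (E' s - C * E s) * exp (- C * (s - t0))) (at s)"
        by (auto intro!: derivative_eq_intros E[OF s'] simp: algebra_simps)
      moreover have "(E' s - C * E s) * exp (- C * (s - t0)) \<le> 0"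
        using E'_bound[OF s'] by (intro mult_nonpos_nonneg) auto
      ultimately show "\<exists>y. ((\<lambda>s. E s * exp (- C * (s - t0))) has_real_derivative y) (at s) \<and> y \<le> 0"
        by blast
    qed
    then show ?thesis by (simp add: E0 mult_le_0_iff not_le[symmetric])
  next
    case False
    have "E t * exp (C * (t - t0)) \<le> E t0 * exp (C * (t0 - t0))"
    proof (rule DERIV_nonneg_imp_nondecreasing[of t t0 "\<lambda>s. E s * exp (C * (s - t0))"])
      show "t \<le> t0" using False by simp
    next
      fix s assume s: "t \<le> s" "s \<le> t0"
      then have s': "\<bar>s - t0\<bar> < r" using t by auto
      have "((\<lambda>s. E s * exp (C * (s - t0))) has_real_derivative
          (E' s + C * E s) * exp (C * (s - t0))) (at s)"
        by (auto intro!: derivative_eq_intros E[OF s'] simp: algebra_simps)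
      moreover have "(E' s + C * E s) * exp (C * (s - t0)) \<ge> 0"
        using E'_bound[OF s'] by (intro mult_nonneg_nonneg) auto
      ultimately show "\<exists>y. ((\<lambda>s. E s * exp (C * (s - t0))) has_real_derivative y) (at s) \<and> y \<ge> 0"
        by blast
    qed
    then show ?thesis by (simp add: E0 mult_le_0_iff not_le[symmetric])
  qed
  then have "d t \<bullet> d t \<le> 0" by (simp add: E_def) (smt (verit) inner_ge_zero)
  then show ?thesis by (metis inner_eq_zero_iff inner_ge_zero order_antisym)
qed

section \<open>Pseudo-Riemannian metrics on an open subset of the model space\<close>

text \<open>The Koszul formula for constant vector fields: the Christoffel symbols with the last index lowered.\<close>

definition koszul :: "('e::real_inner \<Rightarrow> 'e \<Rightarrow> 'e \<Rightarrow> real) \<Rightarrow> 'e \<Rightarrow> 'e \<Rightarrow> 'e \<Rightarrow> 'e \<Rightarrow> real" where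
  "koszul h x u v w =
     (frechet_derivative (\<lambda>y. h y v w) (at x) u
      + frechet_derivative (\<lambda>y. h y u w) (at x) v
      - frechet_derivative (\<lambda>y. h y u v) (at x) w) / 2"

definition christoffel_of :: "('e::real_inner \<Rightarrow> 'e \<Rightarrow> 'e \<Rightarrow> real) \<Rightarrow> 'e \<Rightarrow> 'e \<Rightarrow> 'e \<Rightarrow> 'e" where
  "christoffel_of h x u v = (THE z. \<forall>w. h x z w = koszul h x u v w)"

text \<open>The geodesic equation of a metric given in coordinates, to be applied to the chart
  representations of a curve on a manifold.\<close>

definition geodesic_eq :: "('e::real_inner \<Rightarrow> 'e \<Rightarrow> 'e \<Rightarrow> real) \<Rightarrow> (real \<Rightarrow> 'e) \<Rightarrow> real \<Rightarrow> bool" where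
  "geodesic_eq h y t \<longleftrightarrow>
     vector_derivative (\<lambda>s. vector_derivative y (at s)) (at t)
     + christoffel_of h (y t) (vector_derivative y (at t)) (vector_derivative y (at t)) = 0"

lemma geodesic_eq_cong_open:
  assumes "open J" "t \<in> J" "\<And>s. s \<in> J \<Longrightarrow> y s = z s"
  shows "geodesic_eq h y t \<longleftrightarrow> geodesic_eq h z t"
proof -
  have 1: "vector_derivative y (at s) = vector_derivative z (at s)" if "s \<in> J" for s
    by (rule vector_derivative_cong_open[OF assms(1) that assms(3)])
  have "vector_derivative (\<lambda>s. vector_derivative y (at s)) (at t)
      = vector_derivative (\<lambda>s. vector_derivative z (at s)) (at t)"
    by (rule vector_derivative_cong_open[OF assms(1,2) 1])
  then show ?thesis using 1[OF assms(2)] assms(3)[OF assms(2)] by (simp add: geodesic_eq_def)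
qed

lemma smooth_on_has_vector_derivative:
  assumes "smooth_on J y" "t \<in> J"
  shows "(y has_vector_derivative vector_derivative y (at t)) (at t)"
  using smooth_on_differentiable[OF assms] by (simp add: vector_derivative_works)

lemma smooth_on_vector_derivative:
  assumes "smooth_on J y" "open J"
  shows "smooth_on J (\<lambda>t. vector_derivative y (at t))"
proof -
  have "frechet_derivative y (at t) 1 = vector_derivative y (at t)" if "t \<in> J" for t
    using smooth_on_differentiable[OF assms(1) that] by (simp add: frechet_derivative_eq_vector_derivative)
  then have "C_k_on k J (\<lambda>t. vector_derivative y (at t))" for k
    using smooth_on_derivative[OF assms(1), of 1] unfolding smooth_on_def
    by (rule_tac C_k_on_cong[OF _ assms(2), of k "\<lambda>t. frechet_derivative y (at t) 1"]) auto
  then show ?thesis by (simp add: smooth_on_def)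
qed

locale metric_field = orthonormal_basis B for B :: "'e::real_inner set" +
  fixes S :: "'e set" and h :: "'e \<Rightarrow> 'e \<Rightarrow> 'e \<Rightarrow> real"
  assumes open_S: "open S"
    and linear_left: "x \<in> S \<Longrightarrow> linear (\<lambda>u. h x u v)"
    and sym: "x \<in> S \<Longrightarrow> h x u v = h x v u"
    and nondegenerate: "x \<in> S \<Longrightarrow> (\<And>v. h x u v = 0) \<Longrightarrow> u = 0"
    and smooth: "smooth_on S (\<lambda>x. h x u v)"
begin

lemma linear_right: "x \<in> S \<Longrightarrow> linear (h x u)"
  using linear_left[of x u] sym by (simp add: linear_iff)

abbreviation D :: "'e \<Rightarrow> 'e \<Rightarrow> 'e \<Rightarrow> 'e \<Rightarrow> real" where
  "D x u v k \<equiv> frechet_derivative (\<lambda>y. h y u v) (at x) k"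

lemma has_derivative_D: "x \<in> S \<Longrightarrow> ((\<lambda>y. h y u v) has_derivative D x u v) (at x)"
  using smooth_on_differentiable[OF smooth] frechet_derivative_works by blast

lemma linear_D: "x \<in> S \<Longrightarrow> linear (D x u v)"
  using has_derivative_D has_derivative_linear by blast

lemma D_sym: "x \<in> S \<Longrightarrow> D x u v = D x v u"
  by (intro frechet_derivative_cong_open[OF open_S]) (auto simp: sym)

lemma linear_D_left: "x \<in> S \<Longrightarrow> linear (\<lambda>u. D x u v k)"
proof (rule linearI)
  fix u u' assume x: "x \<in> S"
  have "D x (u + u') v = frechet_derivative (\<lambda>y. h y u v + h y u' v) (at x)"
    by (rule frechet_derivative_cong_open[OF open_S x]) (simp add: linear_add[OF linear_left])
  also have "\<dots> = (\<lambda>k. D x u v k + D x u' v k)"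
    by (rule frechet_derivative_at[symmetric]) (intro has_derivative_add has_derivative_D x)
  finally show "D x (u + u') v k = D x u v k + D x u' v k" by (rule fun_cong)
next
  fix c u assume x: "x \<in> S"
  have "D x (c *\<^sub>R u) v = frechet_derivative (\<lambda>y. c *\<^sub>R h y u v) (at x)"
    by (rule frechet_derivative_cong_open[OF open_S x]) (simp add: linear_scale[OF linear_left])
  also have "\<dots> = (\<lambda>k. c *\<^sub>R D x u v k)"
    by (rule frechet_derivative_at[symmetric]) (intro has_derivative_scaleR_right has_derivative_D x)
  finally show "D x (c *\<^sub>R u) v k = c *\<^sub>R D x u v k" by (rule fun_cong)
qed

lemma linear_D_right: "x \<in> S \<Longrightarrow> linear (\<lambda>v. D x u v k)"
  using linear_D_left[of x u k] by (simp add: D_sym[of x u])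

lemma linear_koszul: "x \<in> S \<Longrightarrow> linear (koszul h x u v)"
  unfolding koszul_def
  by (rule linearI)
     (simp_all add: linear_add[OF linear_D] linear_add[OF linear_D_right]
       linear_scale[OF linear_D] linear_scale[OF linear_D_right] field_simps)

lemma christoffel_of_unique:
  assumes "x \<in> S"
  shows "\<exists>!z. \<forall>w. h x z w = koszul h x u v w"
  by (intro nondegenerate_represents linear_left linear_right linear_koszul assms nondegenerate[OF assms])

lemma christoffel_of: "x \<in> S \<Longrightarrow> h x (christoffel_of h x u v) w = koszul h x u v w"
  using theI'[OF christoffel_of_unique] unfolding christoffel_of_def by blast

lemma eq_if_metric_eq:
  assumes "x \<in> S" "\<And>w. h x u w = h x v w"
  shows "u = v"
proof -
  have "u - v = 0" using assms by (intro nondegenerate[of x]) (simp_all add: linear_diff[OF linear_left])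
  then show ?thesis by simp
qed

lemma christoffel_of_0:
  assumes "x \<in> S"
  shows "christoffel_of h x 0 0 = 0"
proof (rule eq_if_metric_eq[OF assms])
  fix w
  have "D x 0 v k = 0" for v k by (rule linear_0[OF linear_D_left[OF assms]])
  then show "h x (christoffel_of h x 0 0) w = h x 0 w"
    by (simp add: christoffel_of assms koszul_def linear_0[OF linear_D] linear_0[OF linear_left])
qed

text \<open>The product rule for \<open>h (F z) (a z) (b z)\<close>, by using twice that a bilinear form is a family of
  linear maps.\<close>

lemma has_derivative_metric:
  assumes "open U" "x \<in> U" "F ` U \<subseteq> S"
    and F: "(F has_derivative F') (at x)"
    and a: "(a has_derivative a') (at x)" and b: "(b has_derivative b') (at x)"
  shows "((\<lambda>z. h (F z) (a z) (b z)) has_derivative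
    (\<lambda>k. D (F x) (a x) (b x) (F' k) + h (F x) (a' k) (b x) + h (F x) (a x) (b' k))) (at x)"
proof -
  have Fx: "F z \<in> S" if "z \<in> U" for z using assms that by auto
  have *: "((\<lambda>z. h (F z) u v) has_derivative (\<lambda>k. D (F x) u v (F' k))) (at x)" for u v
    by (rule has_derivative_compose[OF F has_derivative_D[OF Fx[OF \<open>x \<in> U\<close>]]])
  have "((\<lambda>z. h (F z) (a z) v) has_derivative (\<lambda>k. D (F x) (a x) v (F' k) + h (F x) (a' k) v)) (at x)" for v
    by (rule has_derivative_linear_family[OF assms(1,2) linear_left *[of _ v] a]) (rule Fx)
  from has_derivative_linear_family[OF assms(1,2) linear_right this b] Fx
  show ?thesis by simp
qed

lemma christoffel_of_minus:
  assumes "x \<in> S"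
  shows "christoffel_of h x (- v) (- v) = christoffel_of h x v v"
proof -
  have "koszul h x (- v) (- v) = koszul h x v v"
    by (rule ext)
       (simp add: koszul_def linear_neg[OF linear_D[OF assms]] linear_neg[OF linear_D_left[OF assms]]
         linear_neg[OF linear_D_right[OF assms]])
  then show ?thesis by (simp add: christoffel_of_def)
qed

text \<open>Reversing time changes the sign of the velocity but not of the acceleration, and the Christoffel
  term is quadratic in the velocity.\<close>

lemma geodesic_eq_reflect:
  assumes "open J" "smooth_on J y" "y ` J \<subseteq> S" "a - t \<in> J" "geodesic_eq h y (a - t)"
  shows "geodesic_eq h (\<lambda>s. y (a - s)) t"
proof -
  define v where "v t = vector_derivative y (at t)" for t
  define R where "R = (\<lambda>s. a - s) -` J"
  have R: "open R" "t \<in> R"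
    using assms unfolding R_def by (auto intro!: open_vimage continuous_intros)
  have refl: "((\<lambda>s. f (a - s)) has_vector_derivative - f') (at s)"
    if "(f has_vector_derivative f') (at (a - s))" for f :: "real \<Rightarrow> 'e" and f' s
  proof -
    have "((\<lambda>s. a - s) has_vector_derivative - 1) (at s)"
      by (auto intro!: derivative_eq_intros)
    from vector_diff_chain_at[OF this that] show ?thesis by (simp add: o_def)
  qed
  have 1: "vector_derivative (\<lambda>s. y (a - s)) (at s) = - v (a - s)" if "s \<in> R" for s
    using that smooth_on_has_vector_derivative[OF assms(2), of "a - s"]
    by (intro vector_derivative_at refl) (auto simp: R_def v_def)
  have "smooth_on J v" unfolding v_def by (rule smooth_on_vector_derivative[OF assms(2,1)])
  then have "((\<lambda>s. v (a - s)) has_vector_derivative - vector_derivative v (at (a - t))) (at t)"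
    using assms(4) by (intro refl smooth_on_has_vector_derivative)
  then have "((\<lambda>s. - v (a - s)) has_vector_derivative vector_derivative v (at (a - t))) (at t)"
    using has_vector_derivative_minus by fastforce
  then have "vector_derivative (\<lambda>s. - v (a - s)) (at t) = vector_derivative v (at (a - t))"
    by (rule vector_derivative_at)
  then have 2: "vector_derivative (\<lambda>s. vector_derivative (\<lambda>s. y (a - s)) (at s)) (at t)
      = vector_derivative v (at (a - t))"
    by (simp add: vector_derivative_cong_open[OF R 1])
  have "y (a - t) \<in> S" using assms by auto
  then show ?thesis
    using assms(5) unfolding geodesic_eq_def 2 1[OF R(2)] v_def
    by (simp add: christoffel_of_minus)
qed

text \<open>The quantitative nondegeneracy at \<open>x0\<close> survives at nearby points: the coefficients of \<open>h\<close> move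
  continuously, and a perturbation by at most half of \<open>norm z\<close> can be absorbed.\<close>

lemma uniform_nondegeneracy:
  assumes "x0 \<in> S"
  obtains M where "M > 0" "\<forall>\<^sub>F x in nhds x0. \<forall>z. norm z \<le> M * (\<Sum>b\<in>B. \<bar>h x z b\<bar>)"
proof -
  obtain M where M: "M > 0" "\<And>z. norm z \<le> M * (\<Sum>b\<in>B. \<bar>h x0 z b\<bar>)"
    using nondegenerate_bound[OF linear_left[OF assms] linear_right[OF assms]] nondegenerate[OF assms]
    by metis
  define \<delta> where "\<delta> x = (\<Sum>b\<in>B. \<Sum>c\<in>B. \<bar>h x c b - h x0 c b\<bar>)" for x
  have "continuous_on S \<delta>"
    unfolding \<delta>_def by (intro continuous_intros smooth_on_continuous[OF smooth])
  then have "isCont \<delta> x0" using assms open_S continuous_on_eq_continuous_at by blast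
  then have "(\<delta> \<longlongrightarrow> \<delta> x0) (nhds x0)" by (simp add: continuous_at tendsto_nhds_iff)
  moreover have "\<delta> x0 < 1 / (2 * M)" using M by (simp add: \<delta>_def)
  ultimately have "\<forall>\<^sub>F x in nhds x0. \<delta> x < 1 / (2 * M)" by (rule order_tendstoD)
  moreover have "\<forall>\<^sub>F x in nhds x0. x \<in> S" using assms open_S by (rule eventually_nhds_in_open[rotated])
  ultimately have "\<forall>\<^sub>F x in nhds x0. \<forall>z. norm z \<le> (2 * M) * (\<Sum>b\<in>B. \<bar>h x z b\<bar>)"
  proof eventually_elim
    case (elim x)
    show ?case
    proof
      fix z
      have *: "\<bar>h x0 z b\<bar> \<le> \<bar>h x z b\<bar> + (\<Sum>c\<in>B. \<bar>h x c b - h x0 c b\<bar>) * norm z" for b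
      proof -
        have "linear (\<lambda>z. h x z b - h x0 z b)"
          using elim assms by (intro linear_compose_sub linear_left)
        from linear_bound[OF this, of z] show ?thesis by simp
      qed
      have "norm z \<le> M * (\<Sum>b\<in>B. \<bar>h x0 z b\<bar>)" by (rule M)
      also have "\<dots> \<le> M * (\<Sum>b\<in>B. \<bar>h x z b\<bar> + (\<Sum>c\<in>B. \<bar>h x c b - h x0 c b\<bar>) * norm z)"
        using M(1) by (intro mult_left_mono sum_mono *) auto
      also have "\<dots> = M * (\<Sum>b\<in>B. \<bar>h x z b\<bar>) + (M * \<delta> x) * norm z"
        by (simp add: \<delta>_def sum.distrib sum_distrib_right[symmetric] distrib_left)
      also have "\<dots> \<le> M * (\<Sum>b\<in>B. \<bar>h x z b\<bar>) + (1 / 2) * norm z"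
        using elim(1) M(1) by (intro add_left_mono mult_right_mono) (auto simp: field_simps)
      finally show "norm z \<le> (2 * M) * (\<Sum>b\<in>B. \<bar>h x z b\<bar>)" by simp
    qed
  qed
  then show ?thesis using that[of "2 * M"] M(1) by simp
qed

text \<open>This functional of the position \<open>x\<close>, velocity \<open>v\<close> and acceleration \<open>a\<close> is
  \<open>Q w (x, v, a) = h x a w + koszul h x v v w\<close>.  It vanishes along every geodesic.  In coordinates it is
  a polynomial in the components of \<open>v\<close> and \<open>a\<close> whose coefficients are smooth in \<open>x\<close>.\<close>

lemma lipschitz_near_geodesic_functional:
  assumes "fst p \<in> S"
  shows "lipschitz_near
    (\<lambda>p. h (fst p) (snd (snd p)) w + koszul h (fst p) (fst (snd p)) (fst (snd p)) w) p"
proof -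
  define Q where "Q p = (\<Sum>b\<in>B. (snd (snd p) \<bullet> b) * h (fst p) b w)
    + ((\<Sum>b\<in>B. \<Sum>c\<in>B. (fst (snd p) \<bullet> b) * ((fst (snd p) \<bullet> c) * D (fst p) b w c))
    + (- 1 / 2) * (\<Sum>b\<in>B. \<Sum>c\<in>B. (fst (snd p) \<bullet> b) * ((fst (snd p) \<bullet> c) * D (fst p) b c w)))"
    for p :: "'e \<times> 'e \<times> 'e"
  have s: "lipschitz_near (\<lambda>p. f (fst p)) p" if "smooth_on S f" for f
    using that C_1_lipschitz_near[OF open_S assms, of f] unfolding smooth_on_def
    by (intro lipschitz_near_fst) auto
  have v: "lipschitz_near (\<lambda>p. fst (snd p) \<bullet> b) p" and a: "lipschitz_near (\<lambda>p. snd (snd p) \<bullet> b) p"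
    for b :: 'e and p :: "'e \<times> 'e \<times> 'e"
    by (intro lipschitz_near_bounded_linear bounded_linear_inner_left_comp bounded_linear_compose[OF bounded_linear_fst]
      bounded_linear_compose[OF bounded_linear_snd] bounded_linear_snd)+
  have "lipschitz_near Q p"
    unfolding Q_def
    by (intro lipschitz_near_add lipschitz_near_sum lipschitz_near_mult lipschitz_near_const v a s
      smooth smooth_on_derivative)
  moreover have "open (S \<times> (UNIV :: ('e \<times> 'e) set))" using open_S by (simp add: open_Times)
  moreover have "p \<in> S \<times> UNIV" using assms by (cases p) auto
  ultimately show ?thesis
  proof (rule lipschitz_near_cong)
    fix p :: "'e \<times> 'e \<times> 'e" assume "p \<in> S \<times> UNIV"
    then obtain x v a where p: "p = (x, v, a)" "x \<in> S" by (cases p) auto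
    have "h x a w = (\<Sum>b\<in>B. (a \<bullet> b) * h x b w)"
      using linear_expansion[OF linear_left[OF p(2)], of a w] by simp
    moreover have "D x v w v = (\<Sum>b\<in>B. \<Sum>c\<in>B. (v \<bullet> b) * ((v \<bullet> c) * D x b w c))"
    proof -
      have "D x v w v = (\<Sum>b\<in>B. (v \<bullet> b) * D x b w v)"
        using linear_expansion[OF linear_D_left[OF p(2)], of v w v] by simp
      also have "\<dots> = (\<Sum>b\<in>B. (v \<bullet> b) * (\<Sum>c\<in>B. (v \<bullet> c) * D x b w c))"
        using linear_expansion[OF linear_D[OF p(2)], of _ w v] by simp
      finally show ?thesis by (simp add: sum_distrib_left)
    qed
    moreover have "D x v v w = (\<Sum>b\<in>B. \<Sum>c\<in>B. (v \<bullet> b) * ((v \<bullet> c) * D x b c w))"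
    proof -
      have "D x v v w = (\<Sum>b\<in>B. (v \<bullet> b) * D x b v w)"
        using linear_expansion[OF linear_D_left[OF p(2)], of v v w] by simp
      also have "\<dots> = (\<Sum>b\<in>B. (v \<bullet> b) * (\<Sum>c\<in>B. (v \<bullet> c) * D x b c w))"
        using linear_expansion[OF linear_D_right[OF p(2)], of _ v w] by simp
      finally show ?thesis by (simp add: sum_distrib_left)
    qed
    ultimately have "Q p = h x a w + (D x v w v + (- 1 / 2) * D x v v w)"
      unfolding Q_def p fst_conv snd_conv by (simp only:)
    then show "Q p = h (fst p) (snd (snd p)) w + koszul h (fst p) (fst (snd p)) (fst (snd p)) w"
      by (simp add: p koszul_def)
  qed
qed

text \<open>With \<open>Q\<close> the functional above, evaluate \<open>Q w\<close> at \<open>(y1, v1, a2)\<close> and at \<open>(y2, v2, a2)\<close>: the second value is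
  \<open>0\<close>, and the first is \<open>h y1 (a2 - a1) w\<close> because \<open>y1\<close> is a geodesic.  So the Lipschitz property together
  with uniform nondegeneracy bounds \<open>a2 - a1\<close> by the differences of positions and velocities, and
  the Gronwall estimate applies.  The acceleration \<open>a2\<close> stands in both
  triples so that only positions and velocities appear in the Lipschitz bound.\<close>

lemma geodesic_eq_unique:
  assumes "open J" "t0 \<in> J"
    and y1: "smooth_on J y1" "y1 ` J \<subseteq> S" "\<And>t. t \<in> J \<Longrightarrow> geodesic_eq h y1 t"
    and y2: "smooth_on J y2" "y2 ` J \<subseteq> S" "\<And>t. t \<in> J \<Longrightarrow> geodesic_eq h y2 t"
    and eq: "y1 t0 = y2 t0" "vector_derivative y1 (at t0) = vector_derivative y2 (at t0)"
  shows "\<forall>\<^sub>F t in nhds t0. y1 t = y2 t"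
proof -
  define v1 where "v1 t = vector_derivative y1 (at t)" for t
  define v2 where "v2 t = vector_derivative y2 (at t)" for t
  define a1 where "a1 t = vector_derivative v1 (at t)" for t
  define a2 where "a2 t = vector_derivative v2 (at t)" for t
  have sm: "smooth_on J v1" "smooth_on J v2" "smooth_on J a1" "smooth_on J a2"
    unfolding v1_def v2_def a1_def a2_def
    by (intro smooth_on_vector_derivative assms)+
  define Q where "Q w p = h (fst p) (snd (snd p)) w + koszul h (fst p) (fst (snd p)) (fst (snd p)) w"
    for w and p :: "'e \<times> 'e \<times> 'e"
  define p1 where "p1 t = (y1 t, v1 t, a2 t)" for t
  define p2 where "p2 t = (y2 t, v2 t, a2 t)" for t
  have cont: "isCont f t0" if "smooth_on J f" for f :: "real \<Rightarrow> 'e"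
    using that smooth_on_continuous continuous_on_eq_continuous_at assms(1,2) by blast
  have p1: "(p1 \<longlongrightarrow> p1 t0) (nhds t0)" and p2: "(p2 \<longlongrightarrow> p2 t0) (nhds t0)"
    using cont[OF y1(1)] cont[OF y2(1)] cont[OF sm(1)] cont[OF sm(2)] cont[OF sm(4)]
    unfolding p1_def p2_def continuous_at tendsto_nhds_iff by (auto intro!: tendsto_Pair)
  have p12: "p2 t0 = p1 t0" using eq by (simp add: p1_def p2_def v1_def v2_def)
  have "\<forall>w. \<exists>K. K \<ge> 0 \<and> (\<forall>\<^sub>F t in nhds t0. \<bar>Q w (p1 t) - Q w (p2 t)\<bar> \<le> K * dist (p1 t) (p2 t))"
  proof
    fix w
    have "lipschitz_near (Q w) (p1 t0)"
      unfolding Q_def using y1 assms(2) by (intro lipschitz_near_geodesic_functional) (auto simp: p1_def)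
    then obtain U K where U: "open U" "p1 t0 \<in> U" "K-lipschitz_on U (Q w)"
      by (auto simp: lipschitz_near_def)
    have "\<forall>\<^sub>F t in nhds t0. p1 t \<in> U" "\<forall>\<^sub>F t in nhds t0. p2 t \<in> U"
      using U p1 p2 p12 by (auto dest: topological_tendstoD)
    then have "\<forall>\<^sub>F t in nhds t0. \<bar>Q w (p1 t) - Q w (p2 t)\<bar> \<le> K * dist (p1 t) (p2 t)"
      by eventually_elim (use U(3) in \<open>auto dest: lipschitz_onD simp: dist_real_def\<close>)
    then show "\<exists>K. K \<ge> 0 \<and> (\<forall>\<^sub>F t in nhds t0. \<bar>Q w (p1 t) - Q w (p2 t)\<bar> \<le> K * dist (p1 t) (p2 t))"
      using lipschitz_on_nonneg[OF U(3)] by blast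
  qed
  from choice[OF this] obtain K where K: "\<And>w. K w \<ge> 0"
    "\<And>w. \<forall>\<^sub>F t in nhds t0. \<bar>Q w (p1 t) - Q w (p2 t)\<bar> \<le> K w * dist (p1 t) (p2 t)" by blast
  obtain M where M: "M > 0" "\<forall>\<^sub>F x in nhds (y1 t0). \<forall>z. norm z \<le> M * (\<Sum>b\<in>B. \<bar>h x z b\<bar>)"
    using uniform_nondegeneracy[of "y1 t0"] y1(2) assms(2) by blast
  define L where "L = M * (\<Sum>b\<in>B. K b)"
  have "L \<ge> 0" using K M by (simp add: L_def sum_nonneg)
  have "\<forall>\<^sub>F t in nhds t0. \<forall>b\<in>B. \<bar>Q b (p1 t) - Q b (p2 t)\<bar> \<le> K b * dist (p1 t) (p2 t)"
    using K(2) finite_B by (simp add: eventually_ball_finite)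
  moreover have "filterlim y1 (nhds (y1 t0)) (nhds t0)"
    using cont[OF y1(1)] by (simp add: continuous_at tendsto_nhds_iff)
  from eventually_compose_filterlim[OF M(2) this]
  have "\<forall>\<^sub>F t in nhds t0. \<forall>z. norm z \<le> M * (\<Sum>b\<in>B. \<bar>h (y1 t) z b\<bar>)" .
  moreover have "\<forall>\<^sub>F t in nhds t0. t \<in> J" using assms by (simp add: eventually_nhds_in_open)
  ultimately have "\<forall>\<^sub>F t in nhds t0. t \<in> J \<and>
      norm (a1 t - a2 t) \<le> L * (norm (y1 t - y2 t) + norm (v1 t - v2 t))"
  proof eventually_elim
    case (elim t)
    have S: "y1 t \<in> S" "y2 t \<in> S" using y1 y2 elim by auto
    have a: "a1 t = - christoffel_of h (y1 t) (v1 t) (v1 t)" "a2 t = - christoffel_of h (y2 t) (v2 t) (v2 t)"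
      using y1(3)[OF elim(3)] y2(3)[OF elim(3)]
      unfolding geodesic_eq_def a1_def a2_def v1_def v2_def by (simp_all add: eq_neg_iff_add_eq_0)
    have Q: "h (y1 t) (a2 t - a1 t) b = Q b (p1 t) - Q b (p2 t)" for b
    proof -
      have "Q b (p2 t) = 0"
        by (simp add: Q_def p2_def a linear_neg[OF linear_left] christoffel_of S)
      moreover have "Q b (p1 t) = h (y1 t) (a2 t - a1 t) b"
        by (simp add: Q_def p1_def a(1) linear_add[OF linear_left] christoffel_of S)
      ultimately show ?thesis by simp
    qed
    have dist: "dist (p1 t) (p2 t) \<le> norm (y1 t - y2 t) + norm (v1 t - v2 t)"
      using sqrt_sum_squares_le_sum[of "norm (y1 t - y2 t)" "norm (v1 t - v2 t)"]
      by (simp add: p1_def p2_def dist_norm norm_Pair)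
    have "norm (a1 t - a2 t) = norm (a2 t - a1 t)" by (rule norm_minus_commute)
    also have "\<dots> \<le> M * (\<Sum>b\<in>B. \<bar>h (y1 t) (a2 t - a1 t) b\<bar>)" using elim by blast
    also have "\<dots> \<le> M * (\<Sum>b\<in>B. K b * dist (p1 t) (p2 t))"
      using M(1) elim(1) by (intro mult_left_mono sum_mono) (auto simp: Q)
    also have "\<dots> = L * dist (p1 t) (p2 t)" by (simp add: L_def sum_distrib_right)
    also have "\<dots> \<le> L * (norm (y1 t - y2 t) + norm (v1 t - v2 t))"
      using dist \<open>L \<ge> 0\<close> by (rule mult_left_mono)
    finally show ?case using elim(3) by simp
  qed
  then obtain r where r: "r > 0" "\<And>t. \<bar>t - t0\<bar> < r \<Longrightarrow> t \<in> J"
    "\<And>t. \<bar>t - t0\<bar> < r \<Longrightarrow> norm (a1 t - a2 t) \<le> L * (norm (y1 t - y2 t) + norm (v1 t - v2 t))"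
    unfolding eventually_nhds_metric dist_real_def by blast
  have "y1 t - y2 t = 0" if "\<bar>t - t0\<bar> < r" for t
  proof (rule second_order_gronwall[where d = "\<lambda>t. y1 t - y2 t" and d' = "\<lambda>t. v1 t - v2 t"
        and d'' = "\<lambda>t. a1 t - a2 t" and K = L and r = r and ?t0.0 = t0])
    fix t assume t: "\<bar>t - t0\<bar> < r"
    show "((\<lambda>t. y1 t - y2 t) has_vector_derivative v1 t - v2 t) (at t)"
      unfolding v1_def v2_def using r(2)[OF t] y1 y2
      by (intro has_vector_derivative_diff smooth_on_has_vector_derivative)
    show "((\<lambda>t. v1 t - v2 t) has_vector_derivative a1 t - a2 t) (at t)"
      unfolding a1_def a2_def using r(2)[OF t] sm
      by (intro has_vector_derivative_diff smooth_on_has_vector_derivative)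
    show "norm (a1 t - a2 t) \<le> L * (norm (y1 t - y2 t) + norm (v1 t - v2 t))" using r(3)[OF t] .
  qed (use eq that \<open>L \<ge> 0\<close> in \<open>auto simp: v1_def v2_def\<close>)
  then show ?thesis unfolding eventually_nhds_metric dist_real_def using r(1) by auto
qed

end

section \<open>Local isometries in coordinates\<close>

text \<open>For the local representation of an isometry \<open>\<phi>\<close> in two charts, \<open>U\<close> is in general only a part of
  the first chart image \<open>S\<close>: the part that \<open>\<phi>\<close> maps into the domain of the second chart.\<close>

locale local_isometry = source: metric_field B S h + target: metric_field B S' k
  for B :: "'e::real_inner set" and S h S' k +
  fixes U :: "'e set" and F :: "'e \<Rightarrow> 'e"
  assumes open_U: "open U" and U_subset: "U \<subseteq> S" and F_image: "F ` U \<subseteq> S'"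
    and smooth_F: "smooth_on U F"
    and isometric: "x \<in> U \<Longrightarrow>
      k (F x) (frechet_derivative F (at x) u) (frechet_derivative F (at x) v) = h x u v"
begin

abbreviation P :: "'e \<Rightarrow> 'e \<Rightarrow> 'e" where "P x u \<equiv> frechet_derivative F (at x) u"

abbreviation P' :: "'e \<Rightarrow> 'e \<Rightarrow> 'e \<Rightarrow> 'e" where
  "P' x u w \<equiv> frechet_derivative (\<lambda>y. frechet_derivative F (at y) u) (at x) w"

lemma has_derivative_F: "x \<in> U \<Longrightarrow> (F has_derivative P x) (at x)"
  using smooth_on_differentiable[OF smooth_F] frechet_derivative_works by blast

lemma has_derivative_P: "x \<in> U \<Longrightarrow> ((\<lambda>y. P y u) has_derivative P' x u) (at x)"
  using smooth_on_differentiable[OF smooth_on_derivative[OF smooth_F]] frechet_derivative_works by blast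

lemma P'_sym: "x \<in> U \<Longrightarrow> P' x u w = P' x w u"
  using second_derivative_symmetric[OF open_U _ , of x F u w] smooth_F by (simp add: smooth_on_def)

lemma linear_P: "x \<in> U \<Longrightarrow> linear (P x)"
  using has_derivative_F has_derivative_linear by blast

text \<open>The pullback of \<open>k\<close> under \<open>P x\<close> is nondegenerate, so \<open>P x\<close> is injective.\<close>

lemma surj_P:
  assumes "x \<in> U"
  shows "surj (P x)"
proof (rule source.linear_injective_surjective[OF linear_P[OF assms]])
  fix u assume u: "P x u = 0"
  have "h x u v = 0" for v
    using isometric[OF assms, of u v] assms F_image
    by (simp add: u linear_0[OF target.linear_left] image_subset_iff)
  then show "u = 0" using assms U_subset by (intro source.nondegenerate[of x]) auto
qed

lemma metric_derivative_pullback: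
  assumes x: "x \<in> U"
  shows "source.D x u v w =
    target.D (F x) (P x u) (P x v) (P x w) + k (F x) (P' x u w) (P x v) + k (F x) (P x u) (P' x v w)"
proof -
  have "((\<lambda>y. k (F y) (P y u) (P y v)) has_derivative (\<lambda>w. target.D (F x) (P x u) (P x v) (P x w)
      + k (F x) (P' x u w) (P x v) + k (F x) (P x u) (P' x v w))) (at x)"
    by (rule target.has_derivative_metric[OF open_U x F_image
        has_derivative_F[OF x] has_derivative_P[OF x] has_derivative_P[OF x]])
  then have "((\<lambda>y. h y u v) has_derivative (\<lambda>w. target.D (F x) (P x u) (P x v) (P x w)
      + k (F x) (P' x u w) (P x v) + k (F x) (P x u) (P' x v w))) (at x)"
    by (rule has_derivative_transform_within_open[OF _ open_U x]) (rule isometric)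
  from fun_cong[OF frechet_derivative_at[OF this, symmetric]] show ?thesis .
qed

text \<open>The Koszul expressions of \<open>h\<close> and of \<open>k\<close> differ by \<open>k (F x) (P' x u u) (P x w)\<close>: of the second
  derivatives of \<open>F\<close> that come from differentiating \<open>h = F\<^sup>* k\<close>, the terms with \<open>P' x u w\<close> and
  \<open>P' x w u\<close> cancel by symmetry.  Since \<open>P x\<close> is surjective, nondegeneracy of \<open>k\<close> turns this into an
  equation between vectors.\<close>

lemma christoffel_of_transform:
  assumes x: "x \<in> U"
  shows "christoffel_of k (F x) (P x u) (P x u) + P' x u u = P x (christoffel_of h x u u)"
proof -
  have S: "x \<in> S" "F x \<in> S'" using x U_subset F_image by auto
  show ?thesis
  proof (rule target.eq_if_metric_eq[OF S(2)])
    fix w'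
    obtain w where w: "w' = P x w" using surj_P[OF x] by (metis surjD)
    have "k (F x) (P x (christoffel_of h x u u)) w' = koszul h x u u w"
      by (simp add: w isometric x source.christoffel_of S)
    also have "\<dots> = koszul k (F x) (P x u) (P x u) w' + k (F x) (P' x u u) w'"
      by (simp add: koszul_def metric_derivative_pullback[OF x] w P'_sym[OF x, of w u]
        target.sym[OF S(2), of "P' x u w"] field_simps)
    also have "\<dots> = k (F x) (christoffel_of k (F x) (P x u) (P x u) + P' x u u) w'"
      by (simp add: linear_add[OF target.linear_left] target.christoffel_of S)
    finally show "k (F x) (christoffel_of k (F x) (P x u) (P x u) + P' x u u) w'
        = k (F x) (P x (christoffel_of h x u u)) w'" by simp
  qed
qed

lemma has_vector_derivative_compose:
  assumes y: "(y has_vector_derivative v) (at t)" and "y t \<in> U"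
  shows "((\<lambda>t. F (y t)) has_vector_derivative P (y t) v) (at t)"
  using has_derivative_compose[OF y[unfolded has_vector_derivative_def] has_derivative_F[OF assms(2)]]
  by (simp add: has_vector_derivative_def linear_scale[OF linear_P[OF assms(2)]])

text \<open>The acceleration of \<open>F (y t)\<close> is \<open>P' (y t) v v + P (y t) a\<close>, where \<open>v\<close> and \<open>a\<close> are the velocity
  and acceleration of \<open>y\<close>; the first summand is exactly the defect in the transformation law of the Christoffel symbols.\<close>

lemma geodesic_eq_transform:
  assumes "open J" "t \<in> J" "smooth_on J y" "y ` J \<subseteq> U" "geodesic_eq h y t"
  shows "geodesic_eq k (\<lambda>t. F (y t)) t"
proof -
  define v where "v t = vector_derivative y (at t)" for t
  define a where "a = vector_derivative v (at t)"
  have y: "(y has_vector_derivative v s) (at s)" if "s \<in> J" for s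
    unfolding v_def by (rule smooth_on_has_vector_derivative[OF assms(3) that])
  have "smooth_on J v" unfolding v_def by (rule smooth_on_vector_derivative[OF assms(3,1)])
  then have v: "(v has_vector_derivative a) (at t)"
    unfolding a_def using assms(2) by (rule smooth_on_has_vector_derivative)
  have yU: "y s \<in> U" if "s \<in> J" for s using assms(4) that by auto
  have 1: "vector_derivative (\<lambda>t. F (y t)) (at s) = P (y s) (v s)" if "s \<in> J" for s
    by (rule vector_derivative_at[OF has_vector_derivative_compose[OF y[OF that] yU[OF that]]])
  have dP: "((\<lambda>s. P (y s) u) has_derivative (\<lambda>r. P' (y t) u (r *\<^sub>R v t))) (at t)" for u
    by (rule has_derivative_compose[OF y[OF assms(2), unfolded has_vector_derivative_def]
        has_derivative_P[OF yU[OF assms(2)]]])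
  have "linear (P' (y t) u)" for u
    by (rule has_derivative_linear[OF has_derivative_P[OF yU[OF assms(2)]]])
  with source.has_derivative_linear_family[OF assms(1,2) linear_P[OF yU] dP
      v[unfolded has_vector_derivative_def]]
  have "((\<lambda>s. P (y s) (v s)) has_vector_derivative P' (y t) (v t) (v t) + P (y t) a) (at t)"
    by (simp add: has_vector_derivative_def linear_scale linear_P[OF yU[OF assms(2)]] scaleR_add_right)
  then have "vector_derivative (\<lambda>s. P (y s) (v s)) (at t) = P' (y t) (v t) (v t) + P (y t) a"
    by (rule vector_derivative_at)
  then have 2: "vector_derivative (\<lambda>s. vector_derivative (\<lambda>t. F (y t)) (at s)) (at t)
      = P' (y t) (v t) (v t) + P (y t) a"
    by (simp add: vector_derivative_cong_open[OF assms(1,2) 1])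
  have "a + christoffel_of h (y t) (v t) (v t) = 0"
    using assms(5) unfolding geodesic_eq_def a_def v_def by simp
  then have "P (y t) a + P (y t) (christoffel_of h (y t) (v t) (v t)) = 0"
    using linear_P[OF yU[OF assms(2)]] by (metis linear_add linear_0)
  then show ?thesis
    unfolding geodesic_eq_def 2 1[OF assms(2)]
    by (simp add: christoffel_of_transform[OF yU[OF assms(2)], symmetric] algebra_simps)
qed

end

section \<open>Charts, tangent vectors and differentials\<close>

abbreviation local_rep :: "('a, 'e) chart \<Rightarrow> ('a, 'e) chart \<Rightarrow> ('a \<Rightarrow> 'a) \<Rightarrow> 'e \<Rightarrow> 'e" where
  "local_rep c c' \<phi> \<equiv> chart_map c' \<circ> \<phi> \<circ> chart_inv c"

text \<open>The points of the image of \<open>c\<close> at which \<open>local_rep c c' \<phi>\<close> actually describes \<open>\<phi>\<close>.\<close>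

abbreviation rep_dom :: "('a, 'e) chart \<Rightarrow> ('a, 'e) chart \<Rightarrow> ('a \<Rightarrow> 'a) \<Rightarrow> 'e set" where
  "rep_dom c c' \<phi> \<equiv> chart_map c ` (chart_dom c \<inter> \<phi> -` chart_dom c')"

locale pseudo_riemannian = orthonormal_basis B for B :: "'e::real_inner set" +
  fixes X :: "'a topology" and A :: "('a, 'e) chart set" and g :: "('a, 'e) metric_tensor"
  assumes pseudo_riemannian_manifold: "pseudo_riemannian_manifold X A g"
begin

lemma smooth_manifold: "smooth_manifold X A"
  using pseudo_riemannian_manifold by (simp add: pseudo_riemannian_manifold_def)

lemma Hausdorff: "Hausdorff_space X"
  using smooth_manifold by (simp add: smooth_manifold_def)

lemma is_chart: "c \<in> A \<Longrightarrow> is_chart X c"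
  using smooth_manifold by (simp add: smooth_manifold_def)

lemma openin_chart_dom: "c \<in> A \<Longrightarrow> openin X (chart_dom c)"
  using is_chart by (simp add: is_chart_def)

lemma chart_dom_subset: "c \<in> A \<Longrightarrow> chart_dom c \<subseteq> topspace X"
  using openin_chart_dom openin_subset by blast

lemma chart_exists: "p \<in> topspace X \<Longrightarrow> \<exists>c\<in>A. p \<in> chart_dom c"
  using smooth_manifold by (auto simp: smooth_manifold_def)

lemma inj_on_chart: "c \<in> A \<Longrightarrow> inj_on (chart_map c) (chart_dom c)"
  using is_chart[of c] chart_dom_subset[of c] homeomorphic_imp_injective_map[of "subtopology X (chart_dom c)"]
  by (auto simp: is_chart_def Int_absorb1)

lemma chart_inv_chart_map: "c \<in> A \<Longrightarrow> p \<in> chart_dom c \<Longrightarrow> chart_inv c (chart_map c p) = p"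
  by (simp add: chart_inv_def inj_on_chart)

lemma open_chart_image:
  assumes "c \<in> A" "openin X U" "U \<subseteq> chart_dom c"
  shows "open (chart_map c ` U)"
proof -
  have h: "homeomorphic_map (subtopology X (chart_dom c)) (top_of_set (chart_map c ` chart_dom c)) (chart_map c)"
    and o: "open (chart_map c ` chart_dom c)"
    using is_chart[OF assms(1)] by (auto simp: is_chart_def)
  have "openin (subtopology X (chart_dom c)) U"
    using assms by (simp add: openin_open_subtopology openin_chart_dom)
  then have "openin (top_of_set (chart_map c ` chart_dom c)) (chart_map c ` U)"
    using homeomorphic_imp_open_map[OF h] by (simp add: open_map_def)
  then show ?thesis using o openin_open_trans by blast
qed

lemma open_rep_dom:
  assumes "c \<in> A" "c' \<in> A" "continuous_map X X \<phi>"
  shows "open (rep_dom c c' \<phi>)"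
proof (rule open_chart_image[OF assms(1)])
  have "openin X {p \<in> topspace X. \<phi> p \<in> chart_dom c'}"
    using assms(3) openin_chart_dom[OF assms(2)] by (rule openin_continuous_map_preimage)
  then have "openin X (chart_dom c \<inter> {p \<in> topspace X. \<phi> p \<in> chart_dom c'})"
    using openin_chart_dom[OF assms(1)] by blast
  moreover have "chart_dom c \<inter> {p \<in> topspace X. \<phi> p \<in> chart_dom c'} = chart_dom c \<inter> \<phi> -` chart_dom c'"
    using chart_dom_subset[OF assms(1)] by auto
  ultimately show "openin X (chart_dom c \<inter> \<phi> -` chart_dom c')" by simp
qed simp

text \<open>The changes of charts are the local representations of the identity; so the chain rule below,
  with one or both of the maps the identity, also contains their cocycle condition and the compatibility of
  differentials with changes of charts.\<close>

lemma smooth_map_id: "smooth_map X A X A id"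
  using smooth_manifold by (simp add: smooth_map_def smooth_manifold_def transition_def)

lemma transition_local_rep: "transition c c' = local_rep c c' id"
  by (simp add: transition_def)

lemma smooth_map_continuous: "smooth_map X A X A \<phi> \<Longrightarrow> continuous_map X X \<phi>"
  by (simp add: smooth_map_def)

lemma smooth_local_rep:
  "smooth_map X A X A \<phi> \<Longrightarrow> c \<in> A \<Longrightarrow> c' \<in> A \<Longrightarrow> smooth_on (rep_dom c c' \<phi>) (local_rep c c' \<phi>)"
  by (simp add: smooth_map_def)

lemma local_rep_chart_map:
  "c \<in> A \<Longrightarrow> p \<in> chart_dom c \<Longrightarrow> local_rep c c' \<phi> (chart_map c p) = chart_map c' (\<phi> p)"
  by (simp add: chart_inv_chart_map)

lemma local_rep_differentiable:
  assumes "smooth_map X A X A \<phi>" "c \<in> charts_at A p" "c' \<in> charts_at A (\<phi> p)"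
  shows "local_rep c c' \<phi> differentiable (at (chart_map c p))"
  using assms by (intro smooth_on_differentiable[OF smooth_local_rep]) (auto simp: charts_at_def)

lemma local_rep_chain_rule:
  assumes \<phi>: "smooth_map X A X A \<phi>" and \<psi>: "smooth_map X A X A \<psi>"
    and c: "c \<in> charts_at A p" and c': "c' \<in> charts_at A (\<phi> p)" and c'': "c'' \<in> charts_at A (\<psi> (\<phi> p))"
  shows "frechet_derivative (local_rep c c'' (\<psi> \<circ> \<phi>)) (at (chart_map c p)) u =
    frechet_derivative (local_rep c' c'' \<psi>) (at (chart_map c' (\<phi> p)))
      (frechet_derivative (local_rep c c' \<phi>) (at (chart_map c p)) u)"
proof -
  have A: "c \<in> A" "c' \<in> A" "p \<in> chart_dom c" "\<phi> p \<in> chart_dom c'"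
    using c c' by (auto simp: charts_at_def)
  have "frechet_derivative (local_rep c c'' (\<psi> \<circ> \<phi>)) (at (chart_map c p))
      = frechet_derivative (local_rep c' c'' \<psi> \<circ> local_rep c c' \<phi>) (at (chart_map c p))"
  proof (rule frechet_derivative_cong_open[OF open_rep_dom[OF A(1,2) smooth_map_continuous[OF \<phi>]]])
    show "chart_map c p \<in> rep_dom c c' \<phi>" using A by auto
    fix x assume "x \<in> rep_dom c c' \<phi>"
    then show "local_rep c c'' (\<psi> \<circ> \<phi>) x = (local_rep c' c'' \<psi> \<circ> local_rep c c' \<phi>) x"
      using A by (auto simp: chart_inv_chart_map)
  qed
  also have "\<dots> = frechet_derivative (local_rep c' c'' \<psi>) (at (chart_map c' (\<phi> p)))
      \<circ> frechet_derivative (local_rep c c' \<phi>) (at (chart_map c p))"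
    unfolding local_rep_chart_map[OF A(1,3), of c' \<phi>, symmetric]
    by (rule frechet_derivative_compose[OF local_rep_differentiable[OF \<phi> c c']])
       (unfold local_rep_chart_map[OF A(1,3)], rule local_rep_differentiable[OF \<psi> c' c''])
  finally show ?thesis by (simp only: comp_apply)
qed

lemma tangent_of_same:
  assumes "c \<in> charts_at A p"
  shows "tangent_of A c p u c = u"
proof -
  have A: "c \<in> A" "p \<in> chart_dom c" using assms by (auto simp: charts_at_def)
  have "frechet_derivative (transition c c) (at (chart_map c p)) = frechet_derivative id (at (chart_map c p))"
    by (rule frechet_derivative_cong_open[OF open_chart_image[OF A(1) openin_chart_dom[OF A(1)] subset_refl]])
       (use A in \<open>auto simp: transition_def chart_inv_chart_map\<close>)
  then show ?thesis using assms by (simp add: tangent_of_def)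
qed

lemma tangent_of_in_tangent_space:
  assumes "c \<in> charts_at A p"
  shows "tangent_of A c p u \<in> tangent_space A p"
proof -
  have "tangent_of A c p u c'' =
      frechet_derivative (transition c' c'') (at (chart_map c' p)) (tangent_of A c p u c')"
    if "c' \<in> charts_at A p" "c'' \<in> charts_at A p" for c' c''
    using local_rep_chain_rule[OF smooth_map_id smooth_map_id assms, of c' c'' u] that
    unfolding tangent_of_def transition_local_rep by (simp only: id_apply id_comp if_True)
  moreover have "tangent_of A c p u c' = 0" if "c' \<notin> charts_at A p" for c'
    using that by (simp add: tangent_of_def)
  ultimately show ?thesis unfolding tangent_space_def by blast
qed

lemma tangent_of_eq:
  assumes "c \<in> charts_at A p" "\<xi> \<in> tangent_space A p"
  shows "tangent_of A c p (\<xi> c) = \<xi>"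
proof
  fix c'
  show "tangent_of A c p (\<xi> c) c' = \<xi> c'"
  proof (cases "c' \<in> charts_at A p")
    case True
    then have "\<xi> c' = frechet_derivative (transition c c') (at (chart_map c p)) (\<xi> c)"
      using assms unfolding tangent_space_def by blast
    with True show ?thesis by (simp only: tangent_of_def if_True)
  next
    case False
    then have "\<xi> c' = 0" using assms(2) unfolding tangent_space_def by blast
    with False show ?thesis by (simp add: tangent_of_def)
  qed
qed

lemma linear_tangent_of:
  assumes "c \<in> charts_at A p"
  shows "linear (\<lambda>u. tangent_of A c p u c')"
proof (cases "c' \<in> charts_at A p")
  case True
  have "transition c c' differentiable (at (chart_map c p))"
    using local_rep_differentiable[OF smooth_map_id assms] True by (simp add: transition_local_rep)
  then show ?thesis using True by (simp add: tangent_of_def linear_frechet_derivative)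
qed (simp add: tangent_of_def module_hom_zero)

text \<open>The differential is computed in an arbitrarily chosen chart \<open>c1\<close>; passing from \<open>c\<close> to \<open>c1\<close> and
  from \<open>c'\<close> to \<open>c''\<close> is two applications of the chain rule, with the identity before or after \<open>\<phi>\<close>.\<close>

lemma differential_tangent_of:
  assumes \<phi>: "smooth_map X A X A \<phi>" and c: "c \<in> charts_at A p" and c': "c' \<in> charts_at A (\<phi> p)"
  shows "differential A \<phi> p (tangent_of A c p u) =
    tangent_of A c' (\<phi> p) (frechet_derivative (local_rep c c' \<phi>) (at (chart_map c p)) u)"
proof
  fix c''
  define c1 where "c1 = (SOME c. c \<in> charts_at A p)"
  have c1: "c1 \<in> charts_at A p" using c unfolding c1_def by (rule someI)
  show "differential A \<phi> p (tangent_of A c p u) c'' =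
    tangent_of A c' (\<phi> p) (frechet_derivative (local_rep c c' \<phi>) (at (chart_map c p)) u) c''"
  proof (cases "c'' \<in> charts_at A (\<phi> p)")
    case True
    have "differential A \<phi> p (tangent_of A c p u) c'' =
        frechet_derivative (local_rep c1 c'' \<phi>) (at (chart_map c1 p))
          (frechet_derivative (local_rep c c1 id) (at (chart_map c p)) u)"
      using True c1
      by (simp add: differential_def Let_def c1_def[symmetric] tangent_of_def transition_local_rep)
    also have "\<dots> = frechet_derivative (local_rep c c'' \<phi>) (at (chart_map c p)) u"
      using local_rep_chain_rule[OF smooth_map_id \<phi> c, of c1 c'' u] c1 True by simp
    also have "\<dots> = frechet_derivative (local_rep c' c'' id) (at (chart_map c' (\<phi> p)))
          (frechet_derivative (local_rep c c' \<phi>) (at (chart_map c p)) u)"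
      using local_rep_chain_rule[OF \<phi> smooth_map_id c c', of c'' u] True by simp
    finally show ?thesis using True by (simp add: tangent_of_def transition_local_rep)
  next
    case False
    then show ?thesis by (simp add: differential_def Let_def tangent_of_def)
  qed
qed

section \<open>The metric and isometries in charts\<close>

lemma metric_in_chart_eq:
  "c \<in> A \<Longrightarrow> p \<in> chart_dom c \<Longrightarrow>
    metric_in_chart A g c (chart_map c p) u v = g p (tangent_of A c p u) (tangent_of A c p v)"
  by (simp add: metric_in_chart_def chart_inv_chart_map)

lemma metric_field_chart:
  assumes "c \<in> A"
  shows "metric_field B (chart_map c ` chart_dom c) (metric_in_chart A g c)"
proof (intro metric_field.intro orthonormal_basis_axioms metric_field_axioms.intro)
  show "open (chart_map c ` chart_dom c)"
    by (rule open_chart_image[OF assms openin_chart_dom[OF assms] subset_refl])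
  show "smooth_on (chart_map c ` chart_dom c) (\<lambda>x. metric_in_chart A g c x u v)" for u v
    using pseudo_riemannian_manifold assms by (simp add: pseudo_riemannian_manifold_def)
  fix x assume "x \<in> chart_map c ` chart_dom c"
  then obtain p where p: "x = chart_map c p" "p \<in> chart_dom c" by auto
  have c: "c \<in> charts_at A p" using assms p by (simp add: charts_at_def)
  let ?T = "tangent_of A c p"
  have h: "metric_in_chart A g c x u v = g p (?T u) (?T v)" for u v
    by (simp add: p metric_in_chart_eq assms)
  have T: "?T u \<in> tangent_space A p" for u by (rule tangent_of_in_tangent_space[OF c])
  have add: "?T (u + v) = (\<lambda>c. ?T u c + ?T v c)" and scale: "?T (r *\<^sub>R u) = (\<lambda>c. r *\<^sub>R ?T u c)" for u v r
    using linear_tangent_of[OF c] by (auto simp: linear_iff)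
  have nip: "nondegenerate_inner_product (tangent_space A p) (g p)"
    using pseudo_riemannian_manifold chart_dom_subset[OF assms] p(2)
    by (auto simp: pseudo_riemannian_manifold_def)
  show "linear (\<lambda>u. metric_in_chart A g c x u v)" for v
    using nip T unfolding h add scale nondegenerate_inner_product_def
    by (intro linearI) (simp_all add: add scale)
  show "metric_in_chart A g c x u v = metric_in_chart A g c x v u" for u v
    using nip T by (simp add: h nondegenerate_inner_product_def)
  show "u = 0" if u: "\<And>v. metric_in_chart A g c x u v = 0" for u
  proof -
    have "g p (?T u) \<eta> = 0" if "\<eta> \<in> tangent_space A p" for \<eta>
      using u[of "\<eta> c"] tangent_of_eq[OF c that] by (simp add: h)
    then have "?T u = (\<lambda>c. 0)" using nip T by (simp add: nondegenerate_inner_product_def)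
    then show "u = 0" using tangent_of_same[OF c, of u] by simp
  qed
qed

lemma isometry_smooth_map: "isometry X A g \<phi> \<Longrightarrow> smooth_map X A X A \<phi>"
  by (simp add: isometry_def diffeomorphism_def)

text \<open>This brings an isometry into coordinates, so that the transformation law of the Christoffel symbols
  applies to its local representations.\<close>

lemma local_isometry_local_rep:
  assumes \<phi>: "isometry X A g \<phi>" and c: "c \<in> A" and c': "c' \<in> A"
  shows "local_isometry B (chart_map c ` chart_dom c) (metric_in_chart A g c)
    (chart_map c' ` chart_dom c') (metric_in_chart A g c') (rep_dom c c' \<phi>) (local_rep c c' \<phi>)"
proof -
  note s = isometry_smooth_map[OF \<phi>]
  interpret source: metric_field B "chart_map c ` chart_dom c" "metric_in_chart A g c"
    by (rule metric_field_chart[OF c])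
  interpret target: metric_field B "chart_map c' ` chart_dom c'" "metric_in_chart A g c'"
    by (rule metric_field_chart[OF c'])
  show ?thesis
  proof unfold_locales
    show "open (rep_dom c c' \<phi>)" by (rule open_rep_dom[OF c c' smooth_map_continuous[OF s]])
    show "rep_dom c c' \<phi> \<subseteq> chart_map c ` chart_dom c" by auto
    show "local_rep c c' \<phi> ` rep_dom c c' \<phi> \<subseteq> chart_map c' ` chart_dom c'"
      using c by (auto simp: chart_inv_chart_map)
    show "smooth_on (rep_dom c c' \<phi>) (local_rep c c' \<phi>)" by (rule smooth_local_rep[OF s c c'])
    fix x u v assume "x \<in> rep_dom c c' \<phi>"
    then obtain p where p: "x = chart_map c p" "p \<in> chart_dom c" "\<phi> p \<in> chart_dom c'" by auto
    have ca: "c \<in> charts_at A p" "c' \<in> charts_at A (\<phi> p)" using c c' p by (auto simp: charts_at_def)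
    let ?P = "frechet_derivative (local_rep c c' \<phi>) (at x)"
    have "metric_in_chart A g c' (local_rep c c' \<phi> x) (?P u) (?P v)
        = g (\<phi> p) (tangent_of A c' (\<phi> p) (?P u)) (tangent_of A c' (\<phi> p) (?P v))"
      using c c' p by (simp add: chart_inv_chart_map metric_in_chart_eq)
    also have "\<dots> = g (\<phi> p) (differential A \<phi> p (tangent_of A c p u)) (differential A \<phi> p (tangent_of A c p v))"
      by (simp add: differential_tangent_of[OF s ca] p(1))
    also have "\<dots> = g p (tangent_of A c p u) (tangent_of A c p v)"
      using \<phi> chart_dom_subset[OF c] p(2) tangent_of_in_tangent_space[OF ca(1)]
      by (auto simp: isometry_def)
    also have "\<dots> = metric_in_chart A g c x u v" using c p by (simp add: metric_in_chart_eq)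
    finally show "metric_in_chart A g c' (local_rep c c' \<phi> x) (?P u) (?P v) = metric_in_chart A g c x u v" .
  qed
qed

lemma christoffel_eq: "christoffel A g c x u v = christoffel_of (metric_in_chart A g c) x u v"
  by (simp add: christoffel_def christoffel_of_def koszul_def)

lemma geodesic_iff:
  "geodesic X A g J \<gamma> \<longleftrightarrow>
     open J \<and> is_interval J \<and> J \<noteq> {} \<and> smooth_curve X A J \<gamma> \<and>
     (\<forall>c\<in>A. \<forall>t\<in>J. \<gamma> t \<in> chart_dom c \<longrightarrow> geodesic_eq (metric_in_chart A g c) (chart_map c \<circ> \<gamma>) t)"
  by (simp add: geodesic_def geodesic_eq_def christoffel_eq Let_def)

section \<open>Operations on geodesics\<close>

lemma geodesic_open: "geodesic X A g J \<gamma> \<Longrightarrow> open J"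
  and geodesic_interval: "geodesic X A g J \<gamma> \<Longrightarrow> is_interval J"
  and geodesic_continuous: "geodesic X A g J \<gamma> \<Longrightarrow> continuous_map (top_of_set J) X \<gamma>"
  by (auto simp: geodesic_iff smooth_curve_def)

lemma geodesic_smooth:
  "geodesic X A g J \<gamma> \<Longrightarrow> c \<in> A \<Longrightarrow> smooth_on (J \<inter> \<gamma> -` chart_dom c) (chart_map c \<circ> \<gamma>)"
  by (auto simp: geodesic_iff smooth_curve_def)

lemma geodesic_geodesic_eq:
  "geodesic X A g J \<gamma> \<Longrightarrow> c \<in> A \<Longrightarrow> t \<in> J \<Longrightarrow> \<gamma> t \<in> chart_dom c \<Longrightarrow>
    geodesic_eq (metric_in_chart A g c) (chart_map c \<circ> \<gamma>) t"
  by (auto simp: geodesic_iff)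

lemma geodesic_topspace: "geodesic X A g J \<gamma> \<Longrightarrow> t \<in> J \<Longrightarrow> \<gamma> t \<in> topspace X"
  using geodesic_continuous by (fastforce simp: continuous_map_def)

lemma open_curve_preimage:
  assumes "open J" "continuous_map (top_of_set J) X \<gamma>" "openin X U"
  shows "open (J \<inter> \<gamma> -` U)"
proof -
  have "openin (top_of_set J) {t \<in> topspace (top_of_set J). \<gamma> t \<in> U}"
    using assms(2,3) by (rule openin_continuous_map_preimage)
  moreover have "{t \<in> topspace (top_of_set J). \<gamma> t \<in> U} = J \<inter> \<gamma> -` U" by auto
  ultimately show ?thesis using assms(1) openin_open_trans by metis
qed

lemma open_geodesic_chart:
  "geodesic X A g J \<gamma> \<Longrightarrow> c \<in> A \<Longrightarrow> open (J \<inter> \<gamma> -` chart_dom c)"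
  by (rule open_curve_preimage[OF geodesic_open geodesic_continuous openin_chart_dom])

text \<open>Being a geodesic is a local property; this serves to restrict and to glue geodesics.\<close>

lemma geodesic_local:
  assumes "open J" "is_interval J" "J \<noteq> {}"
    and loc: "\<And>t. t \<in> J \<Longrightarrow> \<exists>I \<sigma>. t \<in> I \<and> geodesic X A g I \<sigma> \<and> (\<forall>s\<in>I. \<gamma> s = \<sigma> s)"
  shows "geodesic X A g J \<gamma>"
  unfolding geodesic_iff smooth_curve_def continuous_map_def
proof (intro conjI ballI allI impI assms(1-3))
  show "\<gamma> \<in> topspace (top_of_set J) \<rightarrow> topspace X"
  proof
    fix t assume "t \<in> topspace (top_of_set J)"
    then have "t \<in> J" by simp
    from loc[OF this] show "\<gamma> t \<in> topspace X" using geodesic_topspace by metis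
  qed
next
  fix U assume U: "openin X U"
  have "open {t \<in> J. \<gamma> t \<in> U}"
  proof (subst open_subopen, intro ballI)
    fix t assume t: "t \<in> {t \<in> J. \<gamma> t \<in> U}"
    then obtain I \<sigma> where I: "t \<in> I" "geodesic X A g I \<sigma>" "\<forall>s\<in>I. \<gamma> s = \<sigma> s" using loc[of t] by auto
    have "open (J \<inter> (I \<inter> \<sigma> -` U))"
      using assms(1) open_curve_preimage[OF geodesic_open[OF I(2)] geodesic_continuous[OF I(2)] U] by blast
    moreover have "t \<in> J \<inter> (I \<inter> \<sigma> -` U)" "J \<inter> (I \<inter> \<sigma> -` U) \<subseteq> {t \<in> J. \<gamma> t \<in> U}"
      using t I by auto
    ultimately show "\<exists>T. open T \<and> t \<in> T \<and> T \<subseteq> {t \<in> J. \<gamma> t \<in> U}" by blast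
  qed
  moreover have "{t \<in> topspace (top_of_set J). \<gamma> t \<in> U} = {t \<in> J. \<gamma> t \<in> U}" by simp
  ultimately show "openin (top_of_set J) {t \<in> topspace (top_of_set J). \<gamma> t \<in> U}"
    by (simp only: openin_open_eq[OF assms(1)]) auto
next
  fix c assume c: "c \<in> A"
  show "smooth_on (J \<inter> \<gamma> -` chart_dom c) (chart_map c \<circ> \<gamma>)"
    unfolding smooth_on_def
  proof (intro allI C_k_on_local)
    fix k t assume t: "t \<in> J \<inter> \<gamma> -` chart_dom c"
    then obtain I \<sigma> where I: "t \<in> I" "geodesic X A g I \<sigma>" "\<forall>s\<in>I. \<gamma> s = \<sigma> s" using loc[of t] by auto
    have "C_k_on k (I \<inter> \<sigma> -` chart_dom c) (chart_map c \<circ> \<sigma>)"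
      using geodesic_smooth[OF I(2) c] by (simp add: smooth_on_def)
    then have "C_k_on k (I \<inter> \<sigma> -` chart_dom c) (chart_map c \<circ> \<gamma>)"
      by (rule C_k_on_cong[OF _ open_geodesic_chart[OF I(2) c]]) (use I(3) in auto)
    then show "\<exists>U. open U \<and> t \<in> U \<and> C_k_on k U (chart_map c \<circ> \<gamma>)"
      using open_geodesic_chart[OF I(2) c] t I by (intro exI[of _ "I \<inter> \<sigma> -` chart_dom c"]) auto
  qed
next
  fix c t assume c: "c \<in> A" and t: "t \<in> J" "\<gamma> t \<in> chart_dom c"
  obtain I \<sigma> where I: "t \<in> I" "geodesic X A g I \<sigma>" "\<forall>s\<in>I. \<gamma> s = \<sigma> s" using loc[OF t(1)] by auto
  then have "geodesic_eq (metric_in_chart A g c) (chart_map c \<circ> \<sigma>) t"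
    using t c by (intro geodesic_geodesic_eq) auto
  then show "geodesic_eq (metric_in_chart A g c) (chart_map c \<circ> \<gamma>) t"
    using geodesic_eq_cong_open[OF geodesic_open[OF I(2)] I(1), of "chart_map c \<circ> \<gamma>" "chart_map c \<circ> \<sigma>"] I(3)
    by simp
qed

lemma geodesic_subset:
  assumes "geodesic X A g I \<gamma>" "J \<subseteq> I" "open J" "is_interval J" "J \<noteq> {}"
  shows "geodesic X A g J \<gamma>"
  using assms by (intro geodesic_local) auto

lemma geodesic_isometry:
  assumes \<gamma>: "geodesic X A g J \<gamma>" and \<phi>: "isometry X A g \<phi>"
  shows "geodesic X A g J (\<lambda>t. \<phi> (\<gamma> t))"
proof -
  note s = isometry_smooth_map[OF \<phi>]
  have cont: "continuous_map (top_of_set J) X (\<lambda>t. \<phi> (\<gamma> t))"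
    using continuous_map_compose[OF geodesic_continuous[OF \<gamma>] smooth_map_continuous[OF s]]
    by (simp add: o_def)
  define V where "V c c' = (J \<inter> \<gamma> -` chart_dom c) \<inter> (J \<inter> (\<lambda>t. \<phi> (\<gamma> t)) -` chart_dom c')"
    for c c' :: "('a, 'e) chart"
  have V: "open (V c c')" if "c \<in> A" "c' \<in> A" for c c'
    unfolding V_def
    using open_geodesic_chart[OF \<gamma> that(1)]
      open_curve_preimage[OF geodesic_open[OF \<gamma>] cont openin_chart_dom[OF that(2)]] by blast
  have sm: "smooth_on (V c c') (chart_map c \<circ> \<gamma>)" if "c \<in> A" for c c'
    unfolding V_def by (rule smooth_on_subset[OF geodesic_smooth[OF \<gamma> that] Int_lower1])
  have img: "(chart_map c \<circ> \<gamma>) ` V c c' \<subseteq> rep_dom c c' \<phi>" for c c' by (auto simp: V_def)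
  have rep: "local_rep c c' \<phi> ((chart_map c \<circ> \<gamma>) t) = (chart_map c' \<circ> (\<lambda>t. \<phi> (\<gamma> t))) t"
    if "c \<in> A" "t \<in> V c c'" for c c' t
    using that by (simp add: V_def chart_inv_chart_map)
  have chart: "\<exists>c\<in>A. t \<in> V c c'" if "t \<in> J" "\<phi> (\<gamma> t) \<in> chart_dom c'" for t c'
    using chart_exists[OF geodesic_topspace[OF \<gamma> that(1)]] that by (auto simp: V_def)
  show ?thesis
    unfolding geodesic_iff smooth_curve_def
  proof (intro conjI ballI impI cont)
    show "open J" "is_interval J" "J \<noteq> {}" using \<gamma> by (auto simp: geodesic_iff)
    fix c' assume c': "c' \<in> A"
    show "smooth_on (J \<inter> (\<lambda>t. \<phi> (\<gamma> t)) -` chart_dom c') (chart_map c' \<circ> (\<lambda>t. \<phi> (\<gamma> t)))"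
      unfolding smooth_on_def
    proof (intro allI C_k_on_local)
      fix k t assume "t \<in> J \<inter> (\<lambda>t. \<phi> (\<gamma> t)) -` chart_dom c'"
      then obtain c where c: "c \<in> A" "t \<in> V c c'" using chart by blast
      have "C_k_on k (V c c') (chart_map c \<circ> \<gamma>)" using sm[OF c(1)] by (simp add: smooth_on_def)
      then have "C_k_on k (V c c') (\<lambda>t. local_rep c c' \<phi> ((chart_map c \<circ> \<gamma>) t))"
        by (rule C_k_on_compose[OF V[OF c(1) c'] open_rep_dom[OF c(1) c' smooth_map_continuous[OF s]]
            img smooth_local_rep[OF s c(1) c']])
      then have "C_k_on k (V c c') (chart_map c' \<circ> (\<lambda>t. \<phi> (\<gamma> t)))"
        by (rule C_k_on_cong[OF _ V[OF c(1) c'] rep[OF c(1)]])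
      then show "\<exists>U. open U \<and> t \<in> U \<and> C_k_on k U (chart_map c' \<circ> (\<lambda>t. \<phi> (\<gamma> t)))"
        using V[OF c(1) c'] c(2) by blast
    qed
    fix t assume t: "t \<in> J" "\<phi> (\<gamma> t) \<in> chart_dom c'"
    then obtain c where c: "c \<in> A" "t \<in> V c c'" using chart by blast
    interpret local_isometry B "chart_map c ` chart_dom c" "metric_in_chart A g c"
      "chart_map c' ` chart_dom c'" "metric_in_chart A g c'" "rep_dom c c' \<phi>" "local_rep c c' \<phi>"
      by (rule local_isometry_local_rep[OF \<phi> c(1) c'])
    have "geodesic_eq (metric_in_chart A g c) (chart_map c \<circ> \<gamma>) t"
      using c by (intro geodesic_geodesic_eq[OF \<gamma>]) (auto simp: V_def)
    then have "geodesic_eq (metric_in_chart A g c') (\<lambda>t. local_rep c c' \<phi> ((chart_map c \<circ> \<gamma>) t)) t"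
      by (rule geodesic_eq_transform[OF V[OF c(1) c'] c(2) sm[OF c(1)] img])
    then show "geodesic_eq (metric_in_chart A g c') (chart_map c' \<circ> (\<lambda>t. \<phi> (\<gamma> t))) t"
      by (simp only: geodesic_eq_cong_open[OF V[OF c(1) c'] c(2) rep[OF c(1)]])
  qed
qed

lemma geodesic_reflect:
  assumes \<gamma>: "geodesic X A g J \<gamma>"
  shows "geodesic X A g ((\<lambda>s. a - s) -` J) (\<lambda>s. \<gamma> (a - s))"
proof -
  let ?R = "(\<lambda>s. a - s) -` J"
  have pre: "?R \<inter> (\<lambda>s. \<gamma> (a - s)) -` W = (\<lambda>s. a - s) -` (J \<inter> \<gamma> -` W)" for W by auto
  show ?thesis
    unfolding geodesic_iff smooth_curve_def
  proof (intro conjI ballI impI)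
    show "open ?R" using geodesic_open[OF \<gamma>] by (intro open_vimage continuous_intros)
    show "is_interval ?R"
      unfolding is_interval_1
    proof (intro ballI allI impI)
      fix r s t assume "r \<in> ?R" "s \<in> ?R" "r \<le> t \<and> t \<le> s"
      then have "a - t \<in> J"
        by (rule_tac mem_is_interval_1_I[OF geodesic_interval[OF \<gamma>], of "a - s" "a - r"]) auto
      then show "t \<in> ?R" by simp
    qed
    obtain t where "t \<in> J" using \<gamma> by (auto simp: geodesic_iff)
    then have "a - t \<in> ?R" by simp
    then show "?R \<noteq> {}" by blast
    have "continuous_map (top_of_set ?R) (top_of_set J) (\<lambda>s. a - s)"
      by (auto simp: continuous_map_in_subtopology intro!: continuous_intros)
    from continuous_map_compose[OF this geodesic_continuous[OF \<gamma>]]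
    show "continuous_map (top_of_set ?R) X (\<lambda>s. \<gamma> (a - s))" by (simp add: o_def)
    fix c assume c: "c \<in> A"
    show "smooth_on (?R \<inter> (\<lambda>s. \<gamma> (a - s)) -` chart_dom c) (chart_map c \<circ> (\<lambda>s. \<gamma> (a - s)))"
      using C_k_on_reflect[OF open_geodesic_chart[OF \<gamma> c] geodesic_smooth[OF \<gamma> c], of _ a]
      by (simp add: pre smooth_on_def o_def)
    fix t assume t: "t \<in> ?R" "\<gamma> (a - t) \<in> chart_dom c"
    interpret metric_field B "chart_map c ` chart_dom c" "metric_in_chart A g c"
      by (rule metric_field_chart[OF c])
    have "geodesic_eq (metric_in_chart A g c) (\<lambda>s. (chart_map c \<circ> \<gamma>) (a - s)) t"
      using t geodesic_geodesic_eq[OF \<gamma> c, of "a - t"]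
      by (intro geodesic_eq_reflect[OF open_geodesic_chart[OF \<gamma> c] geodesic_smooth[OF \<gamma> c]]) auto
    then show "geodesic_eq (metric_in_chart A g c) (chart_map c \<circ> (\<lambda>s. \<gamma> (a - s))) t"
      by (simp add: o_def)
  qed
qed

lemma geodesic_const:
  assumes "p \<in> topspace X"
  shows "geodesic X A g UNIV (\<lambda>t. p)"
  unfolding geodesic_iff smooth_curve_def
proof (intro conjI ballI impI)
  show "continuous_map (top_of_set UNIV) X (\<lambda>t. p)" using assms by simp
  fix c assume c: "c \<in> A"
  show "smooth_on (UNIV \<inter> (\<lambda>t. p) -` chart_dom c) (chart_map c \<circ> (\<lambda>t. p))"
    by (simp add: smooth_on_def o_def C_k_on_const)
  interpret metric_field B "chart_map c ` chart_dom c" "metric_in_chart A g c"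
    by (rule metric_field_chart[OF c])
  assume "p \<in> chart_dom c"
  then show "geodesic_eq (metric_in_chart A g c) (chart_map c \<circ> (\<lambda>t. p)) t" for t
    by (simp add: geodesic_eq_def o_def christoffel_of_0)
qed auto

section \<open>Uniqueness of geodesics\<close>

lemma geodesic_locally_unique:
  assumes \<gamma>: "geodesic X A g J \<gamma>" and \<sigma>: "geodesic X A g J \<sigma>" and t: "t \<in> J"
    and c: "c \<in> A" "\<gamma> t \<in> chart_dom c" and eq: "\<gamma> t = \<sigma> t"
      "vector_derivative (chart_map c \<circ> \<gamma>) (at t) = vector_derivative (chart_map c \<circ> \<sigma>) (at t)"
  shows "\<forall>\<^sub>F s in nhds t. \<gamma> s = \<sigma> s"
proof -
  define V where "V = (J \<inter> \<gamma> -` chart_dom c) \<inter> (J \<inter> \<sigma> -` chart_dom c)"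
  interpret metric_field B "chart_map c ` chart_dom c" "metric_in_chart A g c"
    by (rule metric_field_chart[OF c(1)])
  have V: "open V" "t \<in> V"
    using open_geodesic_chart[OF \<gamma> c(1)] open_geodesic_chart[OF \<sigma> c(1)] t c eq by (auto simp: V_def)
  have sm: "smooth_on V (chart_map c \<circ> \<gamma>)" "smooth_on V (chart_map c \<circ> \<sigma>)"
    unfolding V_def
    by (rule smooth_on_subset[OF geodesic_smooth[OF \<gamma> c(1)] Int_lower1],
        rule smooth_on_subset[OF geodesic_smooth[OF \<sigma> c(1)] Int_lower2])
  have "\<forall>\<^sub>F s in nhds t. (chart_map c \<circ> \<gamma>) s = (chart_map c \<circ> \<sigma>) s"
  proof (rule geodesic_eq_unique[OF V sm(1) _ _ sm(2)])
    show "geodesic_eq (metric_in_chart A g c) (chart_map c \<circ> \<gamma>) s" if "s \<in> V" for s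
      using that by (intro geodesic_geodesic_eq[OF \<gamma> c(1)]) (auto simp: V_def)
    show "geodesic_eq (metric_in_chart A g c) (chart_map c \<circ> \<sigma>) s" if "s \<in> V" for s
      using that by (intro geodesic_geodesic_eq[OF \<sigma> c(1)]) (auto simp: V_def)
  qed (use eq in \<open>auto simp: V_def\<close>)
  moreover have "\<forall>\<^sub>F s in nhds t. s \<in> V" using V by (rule eventually_nhds_in_open)
  ultimately show ?thesis
    by eventually_elim (use inj_on_chart[OF c(1)] in \<open>auto simp: V_def inj_on_def\<close>)
qed

text \<open>Let \<open>E\<close> be the open set of parameters near which the two geodesics agree.  Its complement in \<open>J\<close> is
  open as well: at a parameter outside \<open>E\<close> either the positions differ, which is an open condition as
  \<open>X\<close> is Hausdorff, or the positions agree and, by local uniqueness, the velocities differ in some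
  chart, which is an open condition by continuity and cannot hold on \<open>E\<close>.  An interval is connected.\<close>

lemma geodesic_unique:
  assumes \<gamma>: "geodesic X A g J \<gamma>" and \<sigma>: "geodesic X A g J \<sigma>" and t0: "t0 \<in> J"
    and c: "c \<in> A" "\<gamma> t0 \<in> chart_dom c" and eq: "\<gamma> t0 = \<sigma> t0"
      "vector_derivative (chart_map c \<circ> \<gamma>) (at t0) = vector_derivative (chart_map c \<circ> \<sigma>) (at t0)"
    and t: "t \<in> J"
  shows "\<gamma> t = \<sigma> t"
proof -
  define E where "E = {t. \<forall>\<^sub>F s in nhds t. \<gamma> s = \<sigma> s}"
  have E_eq: "\<gamma> t = \<sigma> t" if "t \<in> E" for t
    using that eventually_nhds_x_imp_x by (fastforce simp: E_def)
  have E_vel: "vector_derivative (chart_map c \<circ> \<gamma>) (at t) = vector_derivative (chart_map c \<circ> \<sigma>) (at t)"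
    if "t \<in> E" for t c
  proof (rule vector_derivative_cong_eq)
    show "\<forall>\<^sub>F x in nhds t. x \<in> UNIV \<longrightarrow> (chart_map c \<circ> \<gamma>) x = (chart_map c \<circ> \<sigma>) x"
      using that unfolding E_def mem_Collect_eq by (auto elim: eventually_mono)
  qed auto
  have "open E"
    unfolding E_def open_subopen[of "Collect _"] eventually_nhds by blast
  moreover have "open (J - E)"
  proof (subst open_subopen, intro ballI)
    fix t assume t: "t \<in> J - E"
    show "\<exists>T. open T \<and> t \<in> T \<and> T \<subseteq> J - E"
    proof (cases "\<gamma> t = \<sigma> t")
      case False
      have "closedin (top_of_set J) {s \<in> topspace (top_of_set J). \<gamma> s = \<sigma> s}"
        by (rule closedin_continuous_maps_eq[OF Hausdorff geodesic_continuous[OF \<gamma>] geodesic_continuous[OF \<sigma>]])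
      then have "openin (top_of_set J) (J - {s \<in> J. \<gamma> s = \<sigma> s})"
        by (simp add: closedin_def)
      then have "open (J - {s \<in> J. \<gamma> s = \<sigma> s})"
        using geodesic_open[OF \<gamma>] openin_open_trans by blast
      then show ?thesis using t False E_eq by (intro exI[of _ "J - {s \<in> J. \<gamma> s = \<sigma> s}"]) auto
    next
      case True
      have tJ: "t \<in> J" using t by simp
      obtain c where c: "c \<in> A" "\<gamma> t \<in> chart_dom c" using chart_exists[OF geodesic_topspace[OF \<gamma> tJ]] by blast
      define V where "V = (J \<inter> \<gamma> -` chart_dom c) \<inter> (J \<inter> \<sigma> -` chart_dom c)"
      define v where "v s = vector_derivative (chart_map c \<circ> \<gamma>) (at s) - vector_derivative (chart_map c \<circ> \<sigma>) (at s)" for s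
      have V: "open V" "t \<in> V"
        using open_geodesic_chart[OF \<gamma> c(1)] open_geodesic_chart[OF \<sigma> c(1)] t c True by (auto simp: V_def)
      have "smooth_on V (chart_map c \<circ> \<gamma>)" "smooth_on V (chart_map c \<circ> \<sigma>)"
        unfolding V_def
        by (rule smooth_on_subset[OF geodesic_smooth[OF \<gamma> c(1)] Int_lower1],
            rule smooth_on_subset[OF geodesic_smooth[OF \<sigma> c(1)] Int_lower2])
      then have "continuous_on V v"
        unfolding v_def
        by (intro continuous_on_diff smooth_on_continuous smooth_on_vector_derivative V)
      then have "open (V \<inter> v -` (- {0}))"
        using V(1) by (intro continuous_open_preimage) auto
      moreover have "v t \<noteq> 0"
        using geodesic_locally_unique[OF \<gamma> \<sigma> tJ c True] t by (auto simp: v_def E_def)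
      moreover have "v s = 0" if "s \<in> E" for s using E_vel[OF that] by (simp add: v_def)
      ultimately show ?thesis using V(2) by (intro exI[of _ "V \<inter> v -` (- {0})"]) (auto simp: V_def)
    qed
  qed
  moreover have "connected J" using geodesic_interval[OF \<gamma>] by (simp add: is_interval_connected_1)
  ultimately have "E \<inter> J = {} \<or> (J - E) \<inter> J = {}" by (intro connectedD) auto
  moreover have "t0 \<in> E" using geodesic_locally_unique[OF \<gamma> \<sigma> t0 c eq] by (simp add: E_def)
  ultimately have "t \<in> E" using t0 t by blast
  then show ?thesis by (rule E_eq)
qed

section \<open>Reflecting maximal geodesics\<close>

text \<open>If the velocity at \<open>t0\<close> vanishes, uniqueness makes the geodesic constant, and the constant geodesic
  is defined on the whole line.  Otherwise weak symmetry gives an isometry \<open>\<phi>\<close> that fixes \<open>\<gamma> t0\<close> and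
  reverses the velocity there.  The curve \<open>\<sigma> s = \<phi> (\<gamma> (2 * t0 - s))\<close> is a geodesic with the same initial
  data at \<open>t0\<close> as \<open>\<gamma>\<close>, the two sign changes of the velocity cancelling.  So \<open>\<sigma>\<close> and \<open>\<gamma>\<close> agree where
  both are defined and together form a geodesic on \<open>J\<close> and its mirror image; by maximality, the
  mirror image lies in \<open>J\<close>.\<close>

lemma maximal_geodesic_reflect:
  assumes ws: "weakly_symmetric X A g" and max: "maximal_geodesic X A g J \<gamma>"
    and t0: "t0 \<in> J" and s: "s \<in> J"
  shows "2 * t0 - s \<in> J"
proof -
  have \<gamma>: "geodesic X A g J \<gamma>" using max by (simp add: maximal_geodesic_def)
  have ext: "J' = J" if "geodesic X A g J' \<gamma>'" "J \<subseteq> J'" "\<And>t. t \<in> J \<Longrightarrow> \<gamma>' t = \<gamma> t" for J' \<gamma>'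
    using max that unfolding maximal_geodesic_def by blast
  have p: "\<gamma> t0 \<in> topspace X" by (rule geodesic_topspace[OF \<gamma> t0])
  obtain c where c: "c \<in> A" "\<gamma> t0 \<in> chart_dom c" using chart_exists[OF p] by blast
  have ca: "c \<in> charts_at A (\<gamma> t0)" using c by (simp add: charts_at_def)
  define u where "u = vector_derivative (chart_map c \<circ> \<gamma>) (at t0)"
  show ?thesis
  proof (cases "u = 0")
    case True
    have "(\<lambda>t. \<gamma> t0) t = \<gamma> t" if "t \<in> J" for t
    proof (rule geodesic_unique[OF geodesic_subset[OF geodesic_const[OF p]] \<gamma> t0 c(1)])
      show "open J" "is_interval J" "J \<noteq> {}" using \<gamma> by (auto simp: geodesic_iff)
      show "vector_derivative (chart_map c \<circ> (\<lambda>t. \<gamma> t0)) (at t0) = vector_derivative (chart_map c \<circ> \<gamma>) (at t0)"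
        using True by (simp add: u_def o_def)
    qed (use c that in auto)
    then have "UNIV = J" by (intro ext[OF geodesic_const[OF p]]) auto
    then show ?thesis by blast
  next
    case False
    have "tangent_of A c (\<gamma> t0) u \<noteq> (\<lambda>c. 0)" using tangent_of_same[OF ca, of u] False by metis
    then obtain \<phi> where \<phi>: "isometry X A g \<phi>" "\<phi> (\<gamma> t0) = \<gamma> t0"
      "differential A \<phi> (\<gamma> t0) (tangent_of A c (\<gamma> t0) u) = (\<lambda>c'. - tangent_of A c (\<gamma> t0) u c')"
      using ws p tangent_of_in_tangent_space[OF ca] unfolding weakly_symmetric_def by blast
    define R where "R = (\<lambda>s. 2 * t0 - s) -` J"
    define \<rho> where "\<rho> s = \<gamma> (2 * t0 - s)" for s
    define \<sigma> where "\<sigma> s = \<phi> (\<rho> s)" for s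
    have \<rho>: "geodesic X A g R \<rho>" unfolding \<rho>_def R_def by (rule geodesic_reflect[OF \<gamma>])
    have \<sigma>: "geodesic X A g R \<sigma>" unfolding \<sigma>_def by (rule geodesic_isometry[OF \<rho> \<phi>(1)])
    have t0R: "t0 \<in> R" using t0 by (simp add: R_def)
    have \<sigma>t0: "\<sigma> t0 = \<gamma> t0" by (simp add: \<sigma>_def \<rho>_def \<phi>)
    have vel: "vector_derivative (chart_map c \<circ> \<sigma>) (at t0) = u"
    proof -
      interpret local_isometry B "chart_map c ` chart_dom c" "metric_in_chart A g c"
        "chart_map c ` chart_dom c" "metric_in_chart A g c" "rep_dom c c \<phi>" "local_rep c c \<phi>"
        by (rule local_isometry_local_rep[OF \<phi>(1) c(1) c(1)])
      let ?x = "chart_map c (\<gamma> t0)"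
      have x: "?x \<in> rep_dom c c \<phi>" using c \<phi>(2) by auto
      have "- u = (differential A \<phi> (\<gamma> t0) (tangent_of A c (\<gamma> t0) u)) c"
        by (simp add: \<phi>(3) tangent_of_same[OF ca])
      also have "\<dots> = P ?x u"
        using differential_tangent_of[OF isometry_smooth_map[OF \<phi>(1)] ca, of c u] ca
          tangent_of_same[OF ca] by (simp add: \<phi>(2))
      finally have "P ?x u = - u" by (rule sym)
      then have Pu: "P ?x (- u) = u" by (simp add: linear_neg[OF linear_P[OF x]])
      have "((chart_map c \<circ> \<gamma>) has_vector_derivative u) (at (2 * t0 - t0))"
        using smooth_on_has_vector_derivative[OF geodesic_smooth[OF \<gamma> c(1)], of t0] t0 c(2)
        by (simp add: u_def)
      moreover have "((\<lambda>s. 2 * t0 - s) has_vector_derivative - 1) (at t0)"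
        by (auto intro!: derivative_eq_intros)
      ultimately have "((chart_map c \<circ> \<rho>) has_vector_derivative - u) (at t0)"
        using vector_diff_chain_at[of "\<lambda>s. 2 * t0 - s" "- 1" t0] by (fastforce simp: o_def \<rho>_def)
      then have "((\<lambda>t. local_rep c c \<phi> ((chart_map c \<circ> \<rho>) t)) has_vector_derivative u) (at t0)"
        using has_vector_derivative_compose[of "chart_map c \<circ> \<rho>" "- u" t0] x Pu by (simp add: \<rho>_def)
      then have "((chart_map c \<circ> \<sigma>) has_vector_derivative u) (at t0)"
        by (rule has_vector_derivative_transform_within_open[OF _ open_geodesic_chart[OF \<rho> c(1)]])
           (use c t0R in \<open>auto simp: \<sigma>_def \<rho>_def chart_inv_chart_map\<close>)
      then show ?thesis by (rule vector_derivative_at)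
    qed
    have agree: "\<sigma> t = \<gamma> t" if "t \<in> J" "t \<in> R" for t
    proof -
      have JR: "open (J \<inter> R)" "is_interval (J \<inter> R)" "J \<inter> R \<noteq> {}"
        using geodesic_open[OF \<gamma>] geodesic_open[OF \<rho>] geodesic_interval[OF \<gamma>] geodesic_interval[OF \<rho>] t0 t0R
        by (auto intro: is_interval_Int)
      show ?thesis
        by (rule geodesic_unique[OF geodesic_subset[OF \<sigma> _ JR] geodesic_subset[OF \<gamma> _ JR] _ c(1)])
           (use c t0 t0R \<sigma>t0 vel u_def that in auto)
    qed
    define \<gamma>' where "\<gamma>' t = (if t \<in> J then \<gamma> t else \<sigma> t)" for t
    have "geodesic X A g (J \<union> R) \<gamma>'"
    proof (rule geodesic_local)
      show "open (J \<union> R)" using geodesic_open[OF \<gamma>] geodesic_open[OF \<rho>] by blast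
      show "is_interval (J \<union> R)"
        using geodesic_interval[OF \<gamma>] geodesic_interval[OF \<rho>] t0 t0R
        unfolding is_interval_connected_1 by (intro connected_Un) auto
      show "J \<union> R \<noteq> {}" using t0 by blast
      fix t assume "t \<in> J \<union> R"
      then show "\<exists>I \<sigma>. t \<in> I \<and> geodesic X A g I \<sigma> \<and> (\<forall>s\<in>I. \<gamma>' s = \<sigma> s)"
      proof (cases "t \<in> J")
        case True
        then show ?thesis using \<gamma> by (intro exI[of _ J] exI[of _ \<gamma>]) (simp add: \<gamma>'_def)
      next
        case False
        then have "t \<in> R" using \<open>t \<in> J \<union> R\<close> by blast
        then show ?thesis using \<sigma> agree by (intro exI[of _ R] exI[of _ \<sigma>]) (simp add: \<gamma>'_def)
      qed
    qed
    then have "J \<union> R = J" by (rule ext) (auto simp: \<gamma>'_def)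
    moreover have "2 * t0 - s \<in> R" using s by (simp add: R_def)
    ultimately show ?thesis by blast
  qed
qed

end

text \<open>Two points of \<open>J\<close> at distance \<open>\<delta>\<close> generate by reflections an arithmetic progression that is
  unbounded on both sides.\<close>

lemma interval_closed_under_reflection:
  fixes J :: "real set"
  assumes "open J" "is_interval J" "J \<noteq> {}"
    and refl: "\<And>t s. t \<in> J \<Longrightarrow> s \<in> J \<Longrightarrow> 2 * t - s \<in> J"
  shows "J = UNIV"
proof -
  obtain a where a: "a \<in> J" using assms by blast
  obtain r where r: "r > 0" "ball a r \<subseteq> J" using assms(1) a openE by blast
  define \<delta> where "\<delta> = r / 2"
  have \<delta>: "\<delta> > 0" "a + \<delta> \<in> J" using r by (auto simp: \<delta>_def dist_real_def)
  have steps: "a + real n * \<delta> \<in> J \<and> a + real (Suc n) * \<delta> \<in> J" for n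
  proof (induction n)
    case (Suc n)
    then have "2 * (a + real (Suc n) * \<delta>) - (a + real n * \<delta>) \<in> J" by (intro refl) auto
    then have "a + real (Suc (Suc n)) * \<delta> \<in> J" by (simp add: algebra_simps)
    then show ?case using Suc by blast
  qed (use a \<delta> in auto)
  have "x \<in> J" for x
  proof -
    obtain n where n: "\<bar>x - a\<bar> < real n * \<delta>" using \<delta>(1) reals_Archimedean3 by blast
    have "2 * a - (a + real n * \<delta>) \<in> J" using a steps by (intro refl) auto
    moreover have "a + real n * \<delta> \<in> J" using steps by blast
    ultimately show ?thesis by (rule mem_is_interval_1_I[OF assms(2)]) (use n in linarith)+
  qed
  then show ?thesis by blast
qed

theorem proposition4p1:
  fixes X :: "'a topology"
    and A :: "('a, 'e::real_inner) chart set"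
    and g :: "('a, 'e) metric_tensor"
  assumes "pseudo_riemannian_manifold X A g"
    and "weakly_symmetric X A g"
  shows "geodesically_complete X A g"
proof -
  obtain B :: "'e set" where "orthonormal_basis B"
    using assms(1) orthonormal_basis_exists by (auto simp: pseudo_riemannian_manifold_def smooth_manifold_def)
  then interpret pseudo_riemannian B X A g
    by (intro pseudo_riemannian.intro pseudo_riemannian_axioms.intro assms)
  show ?thesis
    unfolding geodesically_complete_def
  proof (intro allI impI)
    fix J \<gamma> assume max: "maximal_geodesic X A g J \<gamma>"
    then have "open J" "is_interval J" "J \<noteq> {}" by (auto simp: maximal_geodesic_def geodesic_iff)
    then show "J = UNIV"
      using maximal_geodesic_reflect[OF assms(2) max] by (rule interval_closed_under_reflection)
  qed
qed

end
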